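(* Let $\mathcal F=(f_t)$ be a continuous flow on a compact metric space $X$, $\varphi\colon X\to\mathbb{R}$ continuous, and $\lambda\colon X\to[0,\infty)$ bounded and lower semicontinuous. For $\eta>0$ let $B(\eta)=\{(x,t): \frac1t\int_0^t\lambda(f_sx)\,ds\le\eta\}$. If the entropy map $\mu\mapsto h_\mu(f_1)$ is upper semicontinuous on the space of $\mathcal F$-invariant Borel probability measures, then $$\lim_{\eta\to0}P(B(\eta),\varphi)\le\sup\Big\{h_\mu(f_1)+\int\varphi\,d\mu : \mu\ \mathcal F\text{-invariant},\ \int\lambda\,d\mu=0\Big\},$$ where both sides are interpreted as $-\infty$ if there is no invariant $\mu$ with $\int\lambda\,d\mu=0$.
   Context: For a collection $\mathcal C$ of orbit segments, with $\mathcal C_t=\{x:(x,t)\in\mathcal C\}$: $\Lambda_t(\mathcal C,\varphi,\varepsilon)=\sup\{\sum_{x\in E}e^{\int_0^t\varphi(f_sx)ds}: E\subset\mathcal C_t\ (t,\varepsilon)\text{-separated}\}$, $P(\mathcal C,\varphi,\varepsilon)=\limsup_{t\to\infty}\frac1t\log\Lambda_t$, $P(\mathcal C,\varphi)=\lim_{\varepsilon\to0}P(\mathcal C,\varphi,\varepsilon)$ (with $\Lambda_t=0$, $\log 0=-\infty$ when $\mathcal C_t=\emptyset$). *)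

theory Defs
  imports "HOL-Analysis.Analysis" "HOL-Probability.Probability"
begin

definition continuous_flow :: "'a::metric_space set \<Rightarrow> (real \<Rightarrow> 'a \<Rightarrow> 'a) \<Rightarrow> bool" where
  "continuous_flow X f \<longleftrightarrow>
     (\<forall>t. f t ` X \<subseteq> X) \<and>
     (\<forall>x\<in>X. f 0 x = x) \<and>
     (\<forall>s t. \<forall>x\<in>X. f (s + t) x = f s (f t x)) \<and>
     continuous_on (UNIV \<times> X) (\<lambda>(t, x). f t x)"

definition lsc_on :: "'a::topological_space set \<Rightarrow> ('a \<Rightarrow> real) \<Rightarrow> bool" where
  "lsc_on X g \<longleftrightarrow> (\<forall>x\<in>X. \<forall>c. c < g x \<longrightarrow> (\<forall>\<^sub>F y in at x within X. c < g y))"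

definition Birkhoff_int :: "(real \<Rightarrow> 'a \<Rightarrow> 'a) \<Rightarrow> ('a \<Rightarrow> real) \<Rightarrow> 'a \<Rightarrow> real \<Rightarrow> real" where
  "Birkhoff_int f g x t = integral {0..t} (\<lambda>s. g (f s x))"

definition separated :: "(real \<Rightarrow> 'a::metric_space \<Rightarrow> 'a) \<Rightarrow> real \<Rightarrow> real \<Rightarrow> 'a set \<Rightarrow> bool" where
  "separated f t \<epsilon> E \<longleftrightarrow> (\<forall>x\<in>E. \<forall>y\<in>E. x \<noteq> y \<longrightarrow> (\<exists>s\<in>{0..t}. dist (f s x) (f s y) > \<epsilon>))"

definition slice :: "('a \<times> real) set \<Rightarrow> real \<Rightarrow> 'a set" where
  "slice C t = {x. (x, t) \<in> C}"

text \<open>\<open>\<Lambda>_t(C,\<phi>,\<epsilon>)\<close>: supremum over finite (t,\<epsilon>)-separated subsets (the empty set gives 0).\<close>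
definition Lambda_t :: "(real \<Rightarrow> 'a::metric_space \<Rightarrow> 'a) \<Rightarrow> ('a \<times> real) set \<Rightarrow> ('a \<Rightarrow> real) \<Rightarrow> real \<Rightarrow> real \<Rightarrow> ereal" where
  "Lambda_t f C \<phi> \<epsilon> t =
     (SUP E\<in>{E. finite E \<and> E \<subseteq> slice C t \<and> separated f t \<epsilon> E}.
        ereal (\<Sum>x\<in>E. exp (Birkhoff_int f \<phi> x t)))"

definition eln :: "ereal \<Rightarrow> ereal" where
  "eln a = (if a = 0 then -\<infinity> else if a = \<infinity> then \<infinity> else ereal (ln (real_of_ereal a)))"

definition pressure_eps :: "(real \<Rightarrow> 'a::metric_space \<Rightarrow> 'a) \<Rightarrow> ('a \<times> real) set \<Rightarrow> ('a \<Rightarrow> real) \<Rightarrow> real \<Rightarrow> ereal" where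
  "pressure_eps f C \<phi> \<epsilon> = Limsup at_top (\<lambda>t::real. ereal (1 / t) * eln (Lambda_t f C \<phi> \<epsilon> t))"

definition pressure :: "(real \<Rightarrow> 'a::metric_space \<Rightarrow> 'a) \<Rightarrow> ('a \<times> real) set \<Rightarrow> ('a \<Rightarrow> real) \<Rightarrow> ereal" where
  "pressure f C \<phi> = Lim (at_right 0) (\<lambda>\<epsilon>. pressure_eps f C \<phi> \<epsilon>)"

definition borel_prob_on :: "'a::topological_space set \<Rightarrow> 'a measure \<Rightarrow> bool" where
  "borel_prob_on X \<mu> \<longleftrightarrow> prob_space \<mu> \<and> sets \<mu> = sets (restrict_space borel X)"

definition flow_invariant :: "'a::topological_space set \<Rightarrow> (real \<Rightarrow> 'a \<Rightarrow> 'a) \<Rightarrow> 'a measure \<Rightarrow> bool" where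
  "flow_invariant X f \<mu> \<longleftrightarrow> borel_prob_on X \<mu> \<and>
     (\<forall>t. \<forall>A\<in>sets \<mu>. emeasure \<mu> (f t -` A \<inter> X) = emeasure \<mu> A)"

definition finite_partition :: "'a measure \<Rightarrow> 'a set set \<Rightarrow> bool" where
  "finite_partition \<mu> P \<longleftrightarrow> finite P \<and> P \<subseteq> sets \<mu> \<and> {} \<notin> P \<and> \<Union>P = space \<mu> \<and>
     disjoint P"

definition part_entropy :: "'a measure \<Rightarrow> 'a set set \<Rightarrow> real" where
  "part_entropy \<mu> P = - (\<Sum>A\<in>P. (if measure \<mu> A = 0 then 0 else measure \<mu> A * ln (measure \<mu> A)))"

definition join :: "'a set set \<Rightarrow> 'a set set \<Rightarrow> 'a set set" where
  "join P Q = {A \<inter> B | A B. A \<in> P \<and> B \<in> Q} - {{}}"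

fun dyn_join :: "'a measure \<Rightarrow> ('a \<Rightarrow> 'a) \<Rightarrow> 'a set set \<Rightarrow> nat \<Rightarrow> 'a set set" where
  "dyn_join \<mu> T P 0 = {space \<mu>}"
| "dyn_join \<mu> T P (Suc n) = join (dyn_join \<mu> T P n) ((\<lambda>A. (T ^^ n) -` A \<inter> space \<mu>) ` P)"

definition entropy_part :: "'a measure \<Rightarrow> ('a \<Rightarrow> 'a) \<Rightarrow> 'a set set \<Rightarrow> real" where
  "entropy_part \<mu> T P = lim (\<lambda>n. part_entropy \<mu> (dyn_join \<mu> T P n) / real n)"

definition ks_entropy :: "'a measure \<Rightarrow> ('a \<Rightarrow> 'a) \<Rightarrow> ereal" where
  "ks_entropy \<mu> T = (SUP P\<in>{P. finite_partition \<mu> P}. ereal (entropy_part \<mu> T P))"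

text \<open>Weak-* convergence of Borel probability measures on the compact metric space X.
  The weak-* topology on probability measures on a compact metric space is metrizable,
  so upper semicontinuity is expressed sequentially.\<close>
definition weak_conv_on :: "'a::topological_space set \<Rightarrow> (nat \<Rightarrow> 'a measure) \<Rightarrow> 'a measure \<Rightarrow> bool" where
  "weak_conv_on X \<mu>s \<mu> \<longleftrightarrow> (\<forall>g::'a \<Rightarrow> real. continuous_on X g \<longrightarrow>
      (\<lambda>n. integral\<^sup>L (\<mu>s n) g) \<longlonglongrightarrow> integral\<^sup>L \<mu> g)"

definition entropy_usc :: "'a::topological_space set \<Rightarrow> (real \<Rightarrow> 'a \<Rightarrow> 'a) \<Rightarrow> bool" where
  "entropy_usc X f \<longleftrightarrow> (\<forall>\<mu>s \<mu>. (\<forall>n. flow_invariant X f (\<mu>s n)) \<longrightarrow> flow_invariant X f \<mu> \<longrightarrow>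
      weak_conv_on X \<mu>s \<mu> \<longrightarrow> limsup (\<lambda>n. ks_entropy (\<mu>s n) (f 1)) \<le> ks_entropy \<mu> (f 1))"

end

theory Submission
  imports Defs
begin

text \<open>
  This is the entropy half of the variational principle, applied along \<open>\<eta> \<rightarrow> 0\<close>. For \<open>c\<close> below the pressure
  of \<open>B(\<eta>)\<close>, take separated sets \<open>E\<^sub>n \<subseteq> B(\<eta>)\<^sub>t\<close> (with \<open>t = t\<^sub>n \<rightarrow> \<infinity>\<close>) whose weighted sums exceed \<open>exp (c t)\<close>,
  weight them by the normalised exponentials of the Birkhoff integrals and average along the flow over
  \<open>[0, t]\<close>. The averages satisfy \<open>\<integral>\<lambda> d\<mu>\<^sub>n \<le> \<eta>\<close>, their weak limits \<open>\<mu>\<close> are invariant, \<open>\<integral>\<lambda> d\<mu> \<le> \<eta>\<close> survives in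
  the limit by lower semicontinuity, and Misiurewicz's argument, run with continuous time offsets so that it
  applies to the flow average directly, gives \<open>c \<le> h\<^sub>\<mu>(f\<^sub>1) + \<integral>\<phi> d\<mu>\<close>. A weak limit of such measures for
  \<open>\<eta> = 1/n\<close> has \<open>\<integral>\<lambda> d\<mu> = 0\<close>, and upper semicontinuity of the entropy preserves the bound.
\<close>

section \<open>Entropy of labellings\<close>

text \<open>The separation scale \<open>\<epsilon>\<close> that witnesses pressure above
  \<open>c\<close> depends on \<open>\<eta>\<close>, so no single partition sees the entropy of all
  the measures obtained; the bound can cross \<open>\<eta> \<rightarrow> 0\<close> only through
  semicontinuity of the entropy itself. For one fixed \<open>\<eta>\<close> the limit is taken by
  hand, with a partition into continuity sets of the limit measure. This forces the order of
  choices: weak limit, then partition, then \<open>n \<rightarrow> \<infinity>\<close> at a fixed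
  block length \<open>q\<close>, and last \<open>q \<rightarrow> \<infinity>\<close>. Integer
  offsets alone would suit averages along \<open>f 1\<close>, whose limits would have to be averaged
  once more to become flow invariant. Since the offsets are real, partitions are handled as
  labellings read along arbitrary finite lists of times: joins become concatenations, and
  \<open>dyn_join\<close> is met only where the bound is handed over to
  \<open>ks_entropy\<close>.\<close>

lemma convergent_subadditive_quotient:
  fixes a :: "nat \<Rightarrow> real"
  assumes sub: "\<And>m n. a (m + n) \<le> a m + a n" and nn: "\<And>n. 0 \<le> a n"
  shows "convergent (\<lambda>n. a n / n)"
proof -
  \<comment> \<open>Fekete's lemma: the limit is the infimum. The index 0 is left out because
    \<open>a 0 / 0 = 0\<close> would spoil it.\<close>
  define L where "L = (INF n\<in>{1..}. a n / real n)"
  have bdd: "bdd_below ((\<lambda>n. a n / real n) ` {1..})"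
    by (rule bdd_belowI2[of _ 0]) (use nn in auto)
  have mult: "a (q * m) \<le> q * a m" if "0 < q" for m q :: nat
    using that
  proof (induction q rule: nat_induct_non_zero)
    case 1 then show ?case by simp
  next
    case (Suc q)
    have "a (Suc q * m) \<le> a m + a (q * m)" using sub[of m "q * m"] by simp
    with Suc show ?case by (simp add: algebra_simps)
  qed
  have "(\<lambda>n. a n / n) \<longlonglongrightarrow> L"
  proof (rule order_tendstoI)
    fix y assume "y < L"
    have "y < a n / n" if "n \<ge> 1" for n
    proof -
      have "L \<le> a n / n" unfolding L_def by (rule cINF_lower[OF bdd]) (use that in auto)
      with \<open>y < L\<close> show ?thesis by simp
    qed
    then show "\<forall>\<^sub>F n in sequentially. y < a n / n" using eventually_sequentially by blast
  next
    fix y assume "L < y"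
    then obtain m :: nat where m: "m \<ge> 1" "a m / m < y"
      unfolding L_def by (subst (asm) cINF_less_iff[OF _ bdd]) auto
    \<comment> \<open>One bound for all remainders \<open>n mod m\<close>; divided by
      \<open>n\<close> it disappears in the limit.\<close>
    define B where "B = (\<Sum>r\<le>m. a r)"
    have aB: "a r \<le> B" if "r \<le> m" for r
      unfolding B_def using that by (intro member_le_sum) (auto simp: nn)
    have bound: "a n / n \<le> a m / m + B / n" if n: "n \<ge> m" for n
    proof -
      define q r where "q = n div m" and "r = n mod m"
      have nq: "n = q * m + r" and "r \<le> m" and "0 < q"
        using m n by (auto simp: q_def r_def div_greater_zero_iff less_imp_le)
      have "a n \<le> q * a m + B"
        using sub[of "q * m" r] mult[OF \<open>0 < q\<close>, of m] aB[OF \<open>r \<le> m\<close>] nq by simp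
      moreover have "real q * a m \<le> n * (a m / m)"
      proof -
        have "real q * m \<le> n" using nq by (metis le_add1 of_nat_le_iff of_nat_mult)
        then have "(real q * m) * (a m / m) \<le> n * (a m / m)" by (intro mult_right_mono) (auto simp: nn)
        then show ?thesis using m by simp
      qed
      ultimately have "a n \<le> n * (a m / m) + B" by simp
      moreover have "0 < real n" using m n by simp
      ultimately show ?thesis by (simp add: field_simps)
    qed
    have "(\<lambda>n. a m / m + B / real n) \<longlonglongrightarrow> a m / m + 0"
      by (intro tendsto_add tendsto_const lim_const_over_n)
    then have "\<forall>\<^sub>F n in sequentially. a m / m + B / real n < y"
      by (rule order_tendstoD) (use m in simp)
    then show "\<forall>\<^sub>F n in sequentially. a n / n < y"
      using eventually_ge_at_top[of m]
    proof eventually_elim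
      case (elim n)
      then show ?case using bound[of n] by linarith
    qed
  qed
  then show ?thesis by (rule convergentI)
qed

text \<open>Labels instead of sets of sets: empty cells never occur in the image, and a common
  refinement is a pair of labels. A null label contributes 0 because of the factor in front of the
  logarithm.\<close>

definition label_entropy :: "'a measure \<Rightarrow> ('a \<Rightarrow> 'b) \<Rightarrow> real" where
  "label_entropy M c = (\<Sum>b\<in>c ` space M. - measure M {x\<in>space M. c x = b} * ln (measure M {x\<in>space M. c x = b}))"

text \<open>Values that are not attained have empty fibres. The sum can thus run over one finite set
  independent of the measure and of time, as termwise limits and integrals require.\<close>

lemma label_entropy_eq_sum:
  assumes "finite B" "c ` space M \<subseteq> B"
  shows "label_entropy M c = (\<Sum>b\<in>B. - measure M {x\<in>space M. c x = b} * ln (measure M {x\<in>space M. c x = b}))"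
  unfolding label_entropy_def
proof (rule sum.mono_neutral_left[OF assms], rule ballI)
  fix b assume "b \<in> B - c ` space M"
  then have "{x\<in>space M. c x = b} = {}" by auto
  then show "- measure M {x\<in>space M. c x = b} * ln (measure M {x\<in>space M. c x = b}) = 0"
    by (simp only: measure_empty)
qed

lemma minus_mult_ln_le_one: "- u * ln u \<le> 1" if "0 \<le> u" for u :: real
proof (cases "u = 0")
  case False
  with that have "u > 0" by simp
  then have "- ln u \<le> 1 / u - 1"
    using ln_le_minus_one[of "1 / u"] by (simp add: ln_div)
  then have "u * - ln u \<le> u * (1 / u - 1)" using \<open>u > 0\<close> by (intro mult_left_mono) auto
  also have "\<dots> = 1 - u" using \<open>u > 0\<close> by (simp add: field_simps)
  finally show ?thesis using that by simp
qed simp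

text \<open>The sharp bound is \<open>ln (card B)\<close>. The crude one is enough, since it only
  pays for two boundary blocks whose cost is divided by \<open>t\<close>.\<close>

lemma label_entropy_le_card:
  assumes "finite B" "c ` space M \<subseteq> B"
  shows "label_entropy M c \<le> card B"
proof -
  have "label_entropy M c \<le> (\<Sum>b\<in>B. 1)"
    unfolding label_entropy_eq_sum[OF assms] by (intro sum_mono minus_mult_ln_le_one) simp
  then show ?thesis by simp
qed

context prob_space
begin

lemma label_entropy_nonneg: "0 \<le> label_entropy M c"
  unfolding label_entropy_def
proof (rule sum_nonneg)
  fix b
  have "0 \<le> prob {x \<in> space M. c x = b} * (- ln (prob {x \<in> space M. c x = b}))"
    using ln_ge_zero_iff[of "1 / prob {x \<in> space M. c x = b}"]
    by (cases "prob {x \<in> space M. c x = b} = 0")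
       (auto intro!: mult_nonneg_nonpos simp: zero_less_measure_iff)
  then show "0 \<le> - prob {x \<in> space M. c x = b} * ln (prob {x \<in> space M. c x = b})" by simp
qed

text \<open>Base \<open>exp 1\<close> turns \<open>log\<close> into \<open>ln\<close>, which opens
  the way to the chain rule and to the fact that conditioning does not increase entropy.\<close>

lemma label_entropy_eq_entropy:
  assumes "simple_function M c"
  shows "label_entropy M c = entropy (exp 1) (count_space (c ` space M)) c"
proof -
  interpret information_space M "exp 1" by unfold_locales auto
  have "{x\<in>space M. c x = b} = c -` {b} \<inter> space M" for b by auto
  then show ?thesis
    by (subst entropy_simple_distributed[OF simple_distributedI[OF assms measure_nonneg refl]])
       (simp add: label_entropy_def log_def sum_negf)
qed

lemma label_entropy_Pair_le:
  assumes "simple_function M c" "simple_function M d"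
  shows "label_entropy M (\<lambda>x. (c x, d x)) \<le> label_entropy M c + label_entropy M d"
proof -
  interpret information_space M "exp 1" by unfold_locales auto
  show ?thesis
    using entropy_chain_rule[OF assms] conditional_entropy_less_eq_entropy[OF assms(2,1)]
    by (simp add: label_entropy_eq_entropy assms simple_function_Pair)
qed

lemma label_entropy_comp_inj:
  assumes "simple_function M c" "inj_on r (c ` space M)"
  shows "label_entropy M (r \<circ> c) = label_entropy M c"
proof -
  interpret information_space M "exp 1" by unfold_locales auto
  show ?thesis
    using entropy_of_inj[OF assms] simple_function_compose[OF assms(1), of r]
    by (simp add: label_entropy_eq_entropy assms)
qed

end

text \<open>The times are an arbitrary list of reals, so that sampling at integers, at integers
  shifted by a real offset, and at unions of such blocks are all instances.\<close>

definition itinerary :: "(real \<Rightarrow> 'a \<Rightarrow> 'a) \<Rightarrow> ('a \<Rightarrow> 'b) \<Rightarrow> real list \<Rightarrow> 'a \<Rightarrow> 'b list" where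
  "itinerary f lab ts x = map (\<lambda>s. lab (f s x)) ts"

lemma simple_function_itinerary:
  assumes "\<And>s. s \<in> set ts \<Longrightarrow> simple_function M (\<lambda>x. lab (f s x))"
  shows "simple_function M (itinerary f lab ts)"
  using assms
proof (induction ts)
  case Nil
  then show ?case by (simp add: itinerary_def[abs_def])
next
  case (Cons s ts)
  then have "simple_function M (\<lambda>x. (lab (f s x), itinerary f lab ts x))"
    by (intro simple_function_Pair) auto
  from simple_function_compose[OF this, of "\<lambda>(a, b). a # b"] show ?case
    by (simp add: itinerary_def[abs_def] comp_def)
qed

lemma (in prob_space) label_entropy_itinerary_append_le:
  assumes "\<And>s. s \<in> set ts \<union> set us \<Longrightarrow> simple_function M (\<lambda>x. lab (f s x))"
  shows "label_entropy M (itinerary f lab (ts @ us))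
    \<le> label_entropy M (itinerary f lab ts) + label_entropy M (itinerary f lab us)"
proof -
  have sf: "simple_function M (itinerary f lab ts)" "simple_function M (itinerary f lab us)"
    by (auto intro!: simple_function_itinerary assms)
  have eq: "itinerary f lab (ts @ us) = (\<lambda>(a, b). a @ b) \<circ> (\<lambda>x. (itinerary f lab ts x, itinerary f lab us x))"
    by (auto simp: itinerary_def)
  \<comment> \<open>All first components have the length of \<open>ts\<close>, so the concatenation
    determines the pair.\<close>
  have "inj_on (\<lambda>(a, b). a @ b) ((\<lambda>x. (itinerary f lab ts x, itinerary f lab us x)) ` space M)"
    by (auto simp: inj_on_def itinerary_def)
  from label_entropy_comp_inj[OF simple_function_Pair[OF sf] this] label_entropy_Pair_le[OF sf]
  show ?thesis unfolding eq by linarith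
qed

lemma (in prob_space) label_entropy_itinerary_concat_le:
  assumes "\<And>ts s. ts \<in> set tss \<Longrightarrow> s \<in> set ts \<Longrightarrow> simple_function M (\<lambda>x. lab (f s x))"
  shows "label_entropy M (itinerary f lab (concat tss))
    \<le> (\<Sum>ts\<leftarrow>tss. label_entropy M (itinerary f lab ts))"
  using assms
proof (induction tss)
  case Nil
  have "space M \<noteq> {}" by (rule not_empty)
  then have "itinerary f lab [] ` space M = {[]}" by (auto simp: itinerary_def)
  then show ?case by (simp add: label_entropy_def itinerary_def prob_space)
next
  case (Cons ts tss)
  have "label_entropy M (itinerary f lab (ts @ concat tss))
    \<le> label_entropy M (itinerary f lab ts) + label_entropy M (itinerary f lab (concat tss))"
    using Cons.prems by (intro label_entropy_itinerary_append_le) auto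
  also have "label_entropy M (itinerary f lab (concat tss)) \<le> (\<Sum>ts\<leftarrow>tss. label_entropy M (itinerary f lab ts))"
    using Cons by auto
  finally show ?case by simp
qed

section \<open>Weak compactness of Borel probability measures\<close>

text \<open>At the first differing digit \<open>m \<le> k\<close> the sums differ by
  \<open>(1/3) ^ m\<close>, and all later digits together can make up for at most half of that. In
  base 2 the tail could cancel the difference completely, as for dyadic rationals; base 3 leaves a
  gap.\<close>

lemma ternary_sum_gap:
  fixes b c :: "nat \<Rightarrow> bool"
  assumes "b k \<noteq> c k"
  shows "(1/3) ^ k / 2 \<le> \<bar>(\<Sum>j. of_bool (b j) * (1/3) ^ j) - (\<Sum>j. of_bool (c j) * (1/3) ^ j :: real)\<bar>"
proof -
  define m where "m = (LEAST j. b j \<noteq> c j)"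
  have m: "b m \<noteq> c m" "m \<le> k"
    using LeastI[of "\<lambda>j. b j \<noteq> c j" k] Least_le[of "\<lambda>j. b j \<noteq> c j" k] assms by (auto simp: m_def)
  have before: "b j = c j" if "j < m" for j
    using not_less_Least[of j "\<lambda>j. b j \<noteq> c j"] that by (auto simp: m_def)
  define d :: "nat \<Rightarrow> real" where "d j = of_bool (b j) - of_bool (c j)" for j
  have d: "\<bar>d j\<bar> \<le> 1" "\<bar>d m\<bar> = 1" for j
    using m by (auto simp: d_def)
  have geo: "summable (\<lambda>j. (1/3::real) ^ j)" by (rule summable_geometric) simp
  have sb: "summable (\<lambda>j. e j * (1/3::real) ^ j)" if "\<And>j. \<bar>e j\<bar> \<le> 1" for e
    by (rule summable_comparison_test[OF _ geo]) (use that in \<open>auto simp: abs_mult intro!: mult_left_le_one_le\<close>)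
  have "(\<Sum>j. of_bool (b j) * (1/3) ^ j) - (\<Sum>j. of_bool (c j) * (1/3) ^ j) = (\<Sum>j. d j * (1/3) ^ j)"
    by (subst suminf_diff) (auto intro!: sb simp: d_def algebra_simps)
  also have "\<dots> = (\<Sum>j. d (j + Suc m) * (1/3) ^ (j + Suc m)) + (\<Sum>j<Suc m. d j * (1/3) ^ j)"
    by (rule suminf_split_initial_segment[OF sb]) (rule d)
  also have "(\<Sum>j<Suc m. d j * (1/3) ^ j) = d m * (1/3) ^ m"
    using before by (simp add: d_def)
  finally have eq: "(\<Sum>j. of_bool (b j) * (1/3) ^ j) - (\<Sum>j. of_bool (c j) * (1/3) ^ j)
    = (\<Sum>j. d (j + Suc m) * (1/3) ^ (j + Suc m)) + d m * (1/3) ^ m" .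
  have geo': "(\<lambda>j. (1/3::real) ^ (j + Suc m)) sums ((1/3) ^ m / 2)"
    using sums_mult2[OF geometric_sums[of "1/3::real"], of "(1/3) ^ Suc m"] by (simp add: power_add)
  have "\<bar>\<Sum>j. d (j + Suc m) * (1/3) ^ (j + Suc m)\<bar> \<le> (\<Sum>j. (1/3::real) ^ (j + Suc m))"
    by (rule norm_suminf_le[of "\<lambda>j. d (j + Suc m) * (1/3) ^ (j + Suc m)", unfolded real_norm_def])
       (use d in \<open>auto simp: abs_mult intro!: mult_left_le_one_le sums_summable[OF geo', simplified]\<close>)
  also have "\<dots> = (1/3) ^ m / 2" using geo' by (simp add: sums_iff)
  finally have "\<bar>\<Sum>j. d (j + Suc m) * (1/3) ^ (j + Suc m)\<bar> \<le> (1/3) ^ m / 2" .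
  moreover have "\<bar>d m * (1/3) ^ m\<bar> = (1/3) ^ m" using d by (simp add: abs_mult)
  moreover have "(1/3::real) ^ k \<le> (1/3) ^ m" using m by (intro power_decreasing) auto
  ultimately show ?thesis unfolding eq by linarith
qed

text \<open>Membership of \<open>x\<close> in countably many small open balls \<open>A k\<close> gives the ternary digits of \<open>\<sigma> x\<close>. Points with
  close codes lie in the same early balls, so the first projection is injective on the compact closure of the
  graph of \<open>\<sigma>\<close>; its inverse yields \<open>\<pi>\<close>.\<close>
lemma compact_metric_real_coding:
  fixes X :: "'a::metric_space set"
  assumes "compact X"
  obtains \<sigma> :: "'a \<Rightarrow> real" and \<pi> :: "real \<Rightarrow> 'a" and K
  where "\<sigma> \<in> borel_measurable borel" "compact K" "\<sigma> ` X \<subseteq> K" "\<pi> ` K \<subseteq> X"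
    "continuous_on K \<pi>" "\<And>x. x \<in> X \<Longrightarrow> \<pi> (\<sigma> x) = x"
proof -
  have "\<exists>D. finite D \<and> X \<subseteq> (\<Union>c\<in>D. ball c (1 / Suc n))" for n :: nat
    using compact_imp_seq_compact[OF assms] seq_compact_imp_totally_bounded[of X] 
    by (metis of_nat_0_less_iff zero_less_Suc zero_less_divide_1_iff)
  then obtain D where D: "\<And>n. finite (D n)" "\<And>n. X \<subseteq> (\<Union>c\<in>D n. ball c (1 / Suc n))" by metis
  \<comment> \<open>The empty set keeps the family nonempty, as its enumeration requires, even if
    all nets \<open>D n\<close> are empty.\<close>
  define \<A> where "\<A> = insert {} (\<Union>n. (\<lambda>c. ball c (1 / Suc n)) ` D n)"
  have "countable \<A>" unfolding \<A>_def using D(1) by (intro countable_insert countable_UN) (auto intro: countable_finite)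
  define A where "A = from_nat_into \<A>"
  have "range A = \<A>" unfolding A_def by (rule range_from_nat_into) (use \<open>countable \<A>\<close> in \<open>auto simp: \<A>_def\<close>)
  have openA: "open (A k)" for k
  proof -
    have "A k \<in> \<A>" using \<open>range A = \<A>\<close> by auto
    then show ?thesis by (auto simp: \<A>_def)
  qed
  have small: "\<exists>k. x \<in> A k \<and> (\<forall>y\<in>A k. dist x y < e)" if x: "x \<in> X" and "0 < e" for x e
  proof -
    obtain n :: nat where n: "1 / Suc n < e / 2" using nat_approx_posE[of "e/2"] \<open>0 < e\<close> by auto
    obtain c where c: "c \<in> D n" "x \<in> ball c (1 / Suc n)" using D(2)[of n] x by auto
    then have "ball c (1 / Suc n) \<in> range A" unfolding \<open>range A = \<A>\<close> by (auto simp: \<A>_def)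
    then obtain k where k: "A k = ball c (1 / Suc n)" by auto
    have "dist x y < e" if "y \<in> A k" for y
      using that c n dist_triangle[of x y c] by (auto simp: k dist_commute)
    with c(2) show ?thesis unfolding k[symmetric] by blast
  qed
  define \<sigma> :: "'a \<Rightarrow> real" where "\<sigma> x = (\<Sum>k. of_bool (x \<in> A k) * (1/3) ^ k)" for x
  have "(\<lambda>x. of_bool (x \<in> A k) :: real) = indicator (A k)" for k by (auto simp: indicator_def)
  then have [measurable]: "(\<lambda>x. of_bool (x \<in> A k) :: real) \<in> borel_measurable borel" for k
    using openA[of k] by simp
  have \<sigma>_meas: "\<sigma> \<in> borel_measurable borel" unfolding \<sigma>_def[abs_def] by measurable
  have geo: "summable (\<lambda>j. (1/3::real) ^ j)" by (rule summable_geometric) simp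
  have sb: "summable (\<lambda>k. of_bool (x \<in> A k) * (1/3::real) ^ k)" for x
    by (rule summable_comparison_test[OF _ geo]) auto
  have \<sigma>_range: "\<sigma> x \<in> {0..3/2}" for x
  proof -
    have "0 \<le> \<sigma> x" unfolding \<sigma>_def by (rule suminf_nonneg[OF sb]) simp
    moreover have "\<sigma> x \<le> (\<Sum>j. (1/3) ^ j)" unfolding \<sigma>_def by (rule suminf_le[OF _ sb geo]) auto
    ultimately show ?thesis by (simp add: suminf_geometric)
  qed
  define G where "G = closure ((\<lambda>x. (\<sigma> x, x)) ` X)"
  have cpt: "compact ({0..3/2::real} \<times> X)" using assms by (intro compact_Times) auto
  have Gsub: "G \<subseteq> {0..3/2} \<times> X" unfolding G_def
    by (rule closure_minimal) (use \<sigma>_range compact_imp_closed[OF cpt] in auto)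
  have "compact G" using compact_Int_closed[OF cpt, of G] Gsub by (simp add: Int_absorb1 G_def)
  have inj: "inj_on fst G"
  proof (rule inj_onI)
    fix p q assume "p \<in> G" "q \<in> G" "fst p = fst q"
    then obtain z x y where pq: "p = (z, x)" "q = (z, y)" by (metis prod.collapse)
    obtain xs where xs: "\<And>n. xs n \<in> X" "(\<lambda>n. (\<sigma> (xs n), xs n)) \<longlonglongrightarrow> (z, x)"
    proof -
      obtain u where "\<And>n. u n \<in> (\<lambda>x. (\<sigma> x, x)) ` X" "u \<longlonglongrightarrow> (z, x)"
        using \<open>p \<in> G\<close> unfolding pq G_def closure_sequential by blast
      moreover from this(1) have "u n = (\<sigma> (snd (u n)), snd (u n))" "snd (u n) \<in> X" for n
        by (smt (verit) imageE snd_conv)+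
      ultimately show ?thesis using that[of "snd \<circ> u"] by (simp add: comp_def)
    qed
    obtain ys where ys: "\<And>n. ys n \<in> X" "(\<lambda>n. (\<sigma> (ys n), ys n)) \<longlonglongrightarrow> (z, y)"
    proof -
      obtain u where "\<And>n. u n \<in> (\<lambda>x. (\<sigma> x, x)) ` X" "u \<longlonglongrightarrow> (z, y)"
        using \<open>q \<in> G\<close> unfolding pq G_def closure_sequential by blast
      moreover from this(1) have "u n = (\<sigma> (snd (u n)), snd (u n))" "snd (u n) \<in> X" for n
        by (smt (verit) imageE snd_conv)+
      ultimately show ?thesis using that[of "snd \<circ> u"] by (simp add: comp_def)
    qed
    have lim: "xs \<longlonglongrightarrow> x" "ys \<longlonglongrightarrow> y" "(\<lambda>n. \<sigma> (xs n) - \<sigma> (ys n)) \<longlonglongrightarrow> 0"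
      using tendsto_snd[OF xs(2)] tendsto_snd[OF ys(2)]
        tendsto_diff[OF tendsto_fst[OF xs(2)] tendsto_fst[OF ys(2)]] by auto
    have "x = y"
    proof (rule ccontr)
      assume "x \<noteq> y"
      have "x \<in> X" using \<open>p \<in> G\<close> Gsub pq by auto
      then obtain k where k: "x \<in> A k" "\<And>y'. y' \<in> A k \<Longrightarrow> dist x y' < dist x y / 2"
        using small[of x "dist x y / 2"] \<open>x \<noteq> y\<close> by auto
      have "\<forall>\<^sub>F n in sequentially. xs n \<in> A k" using topological_tendstoD[OF lim(1) openA k(1)] .
      moreover have "\<forall>\<^sub>F n in sequentially. \<bar>\<sigma> (xs n) - \<sigma> (ys n)\<bar> < (1/3) ^ k / 2"
        using tendstoD[OF lim(3), of "(1/3) ^ k / 2"] by simp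
      moreover have "\<forall>\<^sub>F n in sequentially. dist (ys n) y < dist x y / 2"
        by (rule tendstoD[OF lim(2)]) (use \<open>x \<noteq> y\<close> in simp)
      ultimately have "\<forall>\<^sub>F n in sequentially. False"
      proof eventually_elim
        case (elim n)
        \<comment> \<open>Differing in digit \<open>k\<close> would keep the two codes at least
          \<open>(1/3) ^ k / 2\<close> apart.\<close>
        have "ys n \<in> A k"
          using ternary_sum_gap[of "\<lambda>j. xs n \<in> A j" k "\<lambda>j. ys n \<in> A j"] elim by (auto simp: \<sigma>_def)
        then show ?case using k(2)[of "ys n"] elim(3) dist_triangle[of x y "ys n"] by simp
      qed
      then show False by simp
    qed
    then show "p = q" using pq by simp
  qed
  obtain g where g: "homeomorphism G (fst ` G) fst g"
    using homeomorphism_compact[OF \<open>compact G\<close> _ refl inj] continuous_on_fst[OF continuous_on_id] by auto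
  show ?thesis
  proof (rule that[of \<sigma> "fst ` G" "snd \<circ> g"])
    show "\<sigma> \<in> borel_measurable borel" by (rule \<sigma>_meas)
    show "compact (fst ` G)"
      by (rule compact_continuous_image[OF continuous_on_fst[OF continuous_on_id] \<open>compact G\<close>])
    have inG: "(\<sigma> x, x) \<in> G" if "x \<in> X" for x
      unfolding G_def by (rule subsetD[OF closure_subset imageI[OF that]])
    show "\<sigma> ` X \<subseteq> fst ` G" using image_eqI[OF _ inG, of _ fst] by auto
    show "(snd \<circ> g) ` fst ` G \<subseteq> X"
      unfolding image_comp[symmetric] homeomorphism_image2[OF g] using Gsub by auto
    show "continuous_on (fst ` G) (snd \<circ> g)"
      using homeomorphism_cont2[OF g] by (intro continuous_on_compose continuous_intros) 
    show "(snd \<circ> g) (\<sigma> x) = x" if "x \<in> X" for x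
      using homeomorphism_apply1[OF g inG[OF that]] by simp
  qed
qed

lemma continuous_on_borel_measurable_restrict:
  fixes g :: "'a::topological_space \<Rightarrow> 'b::topological_space"
  assumes "continuous_on X g" "sets \<mu> = sets (restrict_space borel X)"
  shows "g \<in> borel_measurable \<mu>"
  using borel_measurable_continuous_on_restrict[OF assms(1)] measurable_cong_sets[OF assms(2) refl] by blast

lemma borel_prob_on_space: "borel_prob_on X \<mu> \<Longrightarrow> space \<mu> = X"
  unfolding borel_prob_on_def by (metis sets_eq_imp_space_eq space_borel space_restrict_space Int_UNIV_right)

text \<open>Pushing the measures forward along the coding reduces the claim to Helly's theorem on the line; the limit is
  carried by \<open>K\<close>, so it can be pulled back through \<open>\<pi>\<close>.\<close>
lemma borel_prob_on_sequentially_compact: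
  fixes X :: "'a::metric_space set" and \<mu>s :: "nat \<Rightarrow> 'a measure"
  assumes "compact X" and prob: "\<And>n. borel_prob_on X (\<mu>s n)"
  obtains r \<mu> where "strict_mono r" "borel_prob_on X \<mu>" "weak_conv_on X (\<mu>s \<circ> r) \<mu>"
proof -
  obtain \<sigma> :: "'a \<Rightarrow> real" and \<pi> K
    where \<sigma>[measurable]: "\<sigma> \<in> borel_measurable borel" and K: "compact K" "\<sigma> ` X \<subseteq> K"
    and \<pi>: "\<pi> ` K \<subseteq> X" "continuous_on K \<pi>" "\<And>x. x \<in> X \<Longrightarrow> \<pi> (\<sigma> x) = x"
    by (rule compact_metric_real_coding[OF \<open>compact X\<close>]) blast
  have ps: "prob_space (\<mu>s n)" and sets: "sets (\<mu>s n) = sets (restrict_space borel X)"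
    and sp: "space (\<mu>s n) = X" for n
    using prob[of n] borel_prob_on_space by (auto simp: borel_prob_on_def)
  have \<sigma>m[measurable]: "\<sigma> \<in> borel_measurable (\<mu>s n)" for n
    using measurable_restrict_space1[OF \<sigma>, of X] measurable_cong_sets[OF sets refl] by blast
  define \<nu> where "\<nu> n = distr (\<mu>s n) borel \<sigma>" for n
  have rd: "real_distribution (\<nu> n)" for n
    unfolding \<nu>_def using prob_space.real_distribution_distr[OF ps \<sigma>m] .
  obtain x0 where "x0 \<in> X" using prob_space.not_empty[OF ps] sp by blast
  then have "K \<noteq> {}" using K by auto
  have "closed K" using K by (simp add: compact_imp_closed)
  obtain B where B: "\<And>z. z \<in> K \<Longrightarrow> \<bar>z\<bar> \<le> B" "B > 0"
    using compact_imp_bounded[OF K(1)] unfolding bounded_pos real_norm_def by blast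
  have "tight \<nu>" unfolding tight_def
  proof (intro conjI allI impI rd)
    fix \<epsilon> :: real assume "0 < \<epsilon>"
    \<comment> \<open>The interval is open on the left, so its left end is moved strictly below
      \<open>-B\<close>.\<close>
    have "measure (\<nu> n) {-B-1<..B} = 1" for n
    proof -
      have "\<sigma> -` {-B-1<..B} \<inter> space (\<mu>s n) = space (\<mu>s n)" using K(2) B sp by (force simp: abs_le_iff)
      then show ?thesis using prob_space.prob_space[OF ps, of n] by (simp add: \<nu>_def measure_distr)
    qed
    then show "\<exists>a b. a < b \<and> (\<forall>n. 1 - \<epsilon> < measure (\<nu> n) {a<..b})"
      using \<open>0 < \<epsilon>\<close> B(2) by (intro exI[of _ "-B-1"] exI[of _ B]) auto
  qed
  from tight_imp_convergent_subsubsequence[OF this, of id] obtain r M where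
    r: "strict_mono r" and M: "real_distribution M" and wc: "weak_conv_m (\<nu> \<circ> r) M"
    by (auto simp: strict_mono_id[unfolded id_def] comp_def id_def)
  interpret M: real_distribution M by (rule M)
  have conv: "(\<lambda>n. integral\<^sup>L (\<mu>s (r n)) (\<lambda>x. h (\<sigma> x))) \<longlonglongrightarrow> integral\<^sup>L M h"
    if h: "continuous_on UNIV h" "\<And>z. norm (h z) \<le> C" for h :: "real \<Rightarrow> real" and C
  proof -
    have "(\<lambda>n. integral\<^sup>L ((\<nu> \<circ> r) n) h) \<longlonglongrightarrow> integral\<^sup>L M h"
      by (rule weak_conv_imp_integral_bdd_continuous_conv[OF _ M wc])
         (use h rd in \<open>auto simp: continuous_on_eq_continuous_within\<close>)
    moreover have "integral\<^sup>L ((\<nu> \<circ> r) n) h = integral\<^sup>L (\<mu>s (r n)) (\<lambda>x. h (\<sigma> x))" for n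
      unfolding \<nu>_def comp_def
      by (rule integral_distr[OF \<sigma>m]) (rule borel_measurable_continuous_onI[OF h(1)])
    ultimately show ?thesis by simp
  qed
  \<comment> \<open>A bounded continuous function vanishing exactly on the closed set
    \<open>K\<close> has integral 0 along the sequence, hence also for the limit.\<close>
  have AEK: "AE z in M. z \<in> K"
  proof -
    define h where "h z = min 1 (infdist z K)" for z :: real
    have hc: "continuous_on UNIV h" unfolding h_def[abs_def] by (intro continuous_intros)
    have hb: "norm (h z) \<le> 1" for z by (auto simp: h_def infdist_nonneg)
    have [measurable]: "h \<in> borel_measurable borel" using hc by (rule borel_measurable_continuous_onI)
    have "integral\<^sup>L (\<mu>s (r n)) (\<lambda>x. h (\<sigma> x)) = 0" for n
    proof -
      have "integral\<^sup>L (\<mu>s (r n)) (\<lambda>x. h (\<sigma> x)) = integral\<^sup>L (\<mu>s (r n)) (\<lambda>x. 0)"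
        by (rule Bochner_Integration.integral_cong) (use K(2) sp in \<open>auto simp: h_def\<close>)
      then show ?thesis by simp
    qed
    with conv[OF hc hb] have "integral\<^sup>L M h = 0"
      by (simp add: LIMSEQ_unique[OF _ tendsto_const[of "0::real" sequentially]] LIMSEQ_const_iff)
    moreover have "integrable M h"
      by (rule M.integrable_const_bound[of _ 1]) (use hb in auto)
    moreover have "AE z in M. 0 \<le> h z" by (auto simp: h_def infdist_nonneg)
    ultimately have "AE z in M. h z = 0" by (simp add: integral_nonneg_eq_0_iff_AE)
    then show ?thesis
    proof (rule AE_mp, intro AE_I2 impI)
      fix z assume "h z = 0"
      then have "infdist z K = 0" by (auto simp: h_def min_def split: if_splits)
      then show "z \<in> K" using in_closed_iff_infdist_zero[OF \<open>closed K\<close> \<open>K \<noteq> {}\<close>] by simp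
    qed
  qed
  \<comment> \<open>\<open>\<pi>\<close> is controlled only on \<open>K\<close>. The constant
    \<open>x0\<close> outside keeps the map Borel with values in \<open>X\<close>, and by
    \<open>AEK\<close> it is never noticed.\<close>
  define p where "p z = (if z \<in> K then \<pi> z else x0)" for z
  have "p \<in> borel_measurable borel" unfolding p_def[abs_def]
    by (rule borel_measurable_continuous_on_if) (use \<pi>(2) \<open>closed K\<close> in auto)
  then have pm: "p \<in> measurable M (restrict_space borel X)"
    by (intro measurable_restrict_space2) (use \<pi>(1) \<open>x0 \<in> X\<close> in \<open>auto simp: p_def image_subset_iff\<close>)
  define \<mu> where "\<mu> = distr M (restrict_space borel X) p"
  have "borel_prob_on X \<mu>"
    unfolding borel_prob_on_def \<mu>_def using M.prob_space_distr[OF pm] by simp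
  moreover have "weak_conv_on X (\<mu>s \<circ> r) \<mu>"
    unfolding weak_conv_on_def
  proof (intro allI impI)
    fix g :: "'a \<Rightarrow> real" assume g: "continuous_on X g"
    have gK: "continuous_on K (\<lambda>z. g (\<pi> z))" 
      using continuous_on_compose2[OF g \<pi>(2,1)] .
    obtain C where C: "0 \<le> C" "\<And>z. z \<in> K \<Longrightarrow> norm (g (\<pi> z)) \<le> C"
      using compact_imp_bounded[OF compact_continuous_image[OF gK K(1)]]
      unfolding bounded_pos by (auto dest: less_imp_le)
    \<comment> \<open>Convergence on the line tests bounded continuous functions on all of it, while
      \<open>g \<circ> \<pi>\<close> is continuous only on \<open>K\<close>; Tietze extends it with
      the same bound.\<close>
    obtain h where h: "continuous_on UNIV h" "\<And>z. z \<in> K \<Longrightarrow> h z = g (\<pi> z)" "\<And>z. norm (h z) \<le> C"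
      using Tietze[OF gK, of UNIV C] C \<open>closed K\<close> by auto
    have "integral\<^sup>L (\<mu>s (r n)) (\<lambda>x. h (\<sigma> x)) = integral\<^sup>L ((\<mu>s \<circ> r) n) g" for n
      unfolding comp_def by (rule Bochner_Integration.integral_cong) (use K(2) sp h(2) \<pi>(3) in auto)
    moreover have "integral\<^sup>L M h = integral\<^sup>L \<mu> g"
    proof -
      have gm: "g \<in> borel_measurable (restrict_space borel X)"
        by (rule borel_measurable_continuous_on_restrict[OF g])
      have "integral\<^sup>L \<mu> g = integral\<^sup>L M (\<lambda>z. g (p z))"
        unfolding \<mu>_def by (rule integral_distr[OF pm gm])
      also have "\<dots> = integral\<^sup>L M h"
        by (rule integral_cong_AE)
           (use measurable_comp[OF pm gm] borel_measurable_continuous_onI[OF h(1)] AEK h(2)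
            in \<open>auto simp: comp_def p_def\<close>)
      finally show ?thesis ..
    qed
    ultimately show "(\<lambda>n. integral\<^sup>L ((\<mu>s \<circ> r) n) g) \<longlonglongrightarrow> integral\<^sup>L \<mu> g"
      using conv[OF h(1,3)] by simp
  qed
  ultimately show ?thesis using that r by blast
qed

lemma borel_prob_on_integrable:
  assumes "borel_prob_on X \<mu>" "g \<in> borel_measurable (restrict_space borel X)" "\<And>x. x \<in> X \<Longrightarrow> \<bar>g x\<bar> \<le> B"
  shows "integrable \<mu> (g :: _ \<Rightarrow> real)"
proof -
  interpret prob_space \<mu> using assms(1) by (simp add: borel_prob_on_def)
  have "sets \<mu> = sets (restrict_space borel X)" using assms(1) by (simp add: borel_prob_on_def)
  then have "g \<in> borel_measurable \<mu>" using assms(2) measurable_cong_sets[OF _ refl] by blast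
  then show ?thesis
    using assms(3) borel_prob_on_space[OF assms(1)] by (intro integrable_const_bound[of _ B]) auto
qed

lemma borel_prob_on_integrable_continuous:
  assumes "compact X" "borel_prob_on X \<mu>" "continuous_on X (g :: _ \<Rightarrow> real)"
  shows "integrable \<mu> g"
proof -
  obtain B where "\<And>x. x \<in> X \<Longrightarrow> \<bar>g x\<bar> \<le> B"
    using compact_imp_bounded[OF compact_continuous_image[OF assms(3,1)]] by (auto simp: bounded_iff)
  then show ?thesis
    by (rule borel_prob_on_integrable[OF assms(2) borel_measurable_continuous_on_restrict[OF assms(3)]])
qed

text \<open>The approximants are the Lipschitz regularisations \<open>inf\<^sub>y (g y + k d(x, y))\<close>.\<close>
lemma lsc_on_continuous_approx:
  fixes g :: "'a::metric_space \<Rightarrow> real"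
  assumes lsc: "lsc_on X g" and nn: "\<And>x. x \<in> X \<Longrightarrow> 0 \<le> g x"
  obtains L :: "nat \<Rightarrow> 'a \<Rightarrow> real" where "\<And>k. continuous_on X (L k)"
    "\<And>k x. x \<in> X \<Longrightarrow> 0 \<le> L k x" "\<And>k x. x \<in> X \<Longrightarrow> L k x \<le> g x"
    "\<And>x. x \<in> X \<Longrightarrow> (\<lambda>k. L k x) \<longlonglongrightarrow> g x"
proof -
  define L where "L k x = (INF y\<in>X. g y + real k * dist x y)" for k x
  have bdd: "bdd_below ((\<lambda>y. g y + real k * dist x y) ` X)" for k x
    by (rule bdd_belowI2[of _ 0]) (use nn in auto)
  have le: "L k x \<le> g y + k * dist x y" if "y \<in> X" for k x y
    unfolding L_def by (rule cINF_lower[OF bdd that])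
  have ge: "c \<le> L k x" if "x \<in> X" "\<And>y. y \<in> X \<Longrightarrow> c \<le> g y + k * dist x y" for c k x
    unfolding L_def by (rule cINF_greatest) (use that in auto)
  have lip: "L k x \<le> L k y + k * dist x y" if "y \<in> X" for k x y
  proof -
    have "L k x - k * dist x y \<le> L k y"
    proof (rule ge[OF that])
      fix z assume "z \<in> X"
      have "L k x \<le> g z + k * dist x z" using le[OF \<open>z \<in> X\<close>] .
      also have "k * dist x z \<le> k * (dist x y + dist y z)" by (intro mult_left_mono dist_triangle) auto
      finally show "L k x - k * dist x y \<le> g z + k * dist y z" by (simp add: algebra_simps)
    qed
    then show ?thesis by simp
  qed
  show ?thesis
  proof (rule that[of L])
    fix k
    have "k-lipschitz_on X (L k)"
    proof (rule lipschitz_onI)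
      fix x y assume "x \<in> X" "y \<in> X"
      then show "dist (L k x) (L k y) \<le> k * dist x y"
        using lip[of x k y] lip[of y k x] by (simp add: dist_real_def dist_commute)
    qed simp
    then show "continuous_on X (L k)" by (rule lipschitz_on_continuous_on)
    show "0 \<le> L k x" if "x \<in> X" for x using ge[OF that, of 0] nn by simp
    show "L k x \<le> g x" if "x \<in> X" for x using le[OF that, of k x] by simp
  next
    fix x assume x: "x \<in> X"
    show "(\<lambda>k. L k x) \<longlonglongrightarrow> g x"
    proof (rule order_tendstoI)
      fix c assume "g x < c"
      then show "\<forall>\<^sub>F k in sequentially. L k x < c"
        using le[OF x, of _ x] by (intro always_eventually) (auto intro: le_less_trans)
    next
      fix c' assume "c' < g x"
      then obtain c where c: "c' < c" "c < g x" using dense by blast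
      then have "\<forall>\<^sub>F y in at x within X. c < g y" using lsc x by (auto simp: lsc_on_def)
      then obtain d where d: "d > 0" "\<And>y. y \<in> X \<Longrightarrow> y \<noteq> x \<Longrightarrow> dist y x < d \<Longrightarrow> c < g y"
        unfolding eventually_at by blast
      \<comment> \<open>Within distance \<open>d\<close> semicontinuity gives
        \<open>c < g y\<close>; beyond it the penalty alone is at least \<open>c\<close>, because
        \<open>g\<close> is nonnegative.\<close>
      obtain N :: nat where N: "c / d < N" using reals_Archimedean2 by blast
      have "c' < L k x" if "k \<ge> N" for k
      proof -
        have "c \<le> g y + k * dist x y" if "y \<in> X" for y
        proof (cases "dist y x < d")
          case True
          then have "c < g y" using d(2)[OF that] c by (cases "y = x") auto
          moreover have "0 \<le> k * dist x y" by simp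
          ultimately show ?thesis by linarith
        next
          case False
          have "c \<le> N * d" using N d(1) by (simp add: field_simps)
          also have "\<dots> \<le> k * dist x y"
            using False \<open>k \<ge> N\<close> d(1) by (intro mult_mono) (auto simp: dist_commute)
          finally show ?thesis using nn[OF that] by simp
        qed
        then have "c \<le> L k x" by (rule ge[OF x])
        then show ?thesis using c by simp
      qed
      then show "\<forall>\<^sub>F k in sequentially. c' < L k x" using eventually_sequentially by blast
    qed
  qed
qed

section \<open>Semicontinuous and continuous test functions\<close>

lemma lsc_on_borel_measurable:
  fixes g :: "'a::metric_space \<Rightarrow> real"
  assumes "lsc_on X g" "\<And>x. x \<in> X \<Longrightarrow> 0 \<le> g x"
  shows "g \<in> borel_measurable (restrict_space borel X)"
proof -
  obtain L :: "nat \<Rightarrow> 'a \<Rightarrow> real" where L: "\<And>k. continuous_on X (L k)"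
    "\<And>k x. x \<in> X \<Longrightarrow> 0 \<le> L k x" "\<And>k x. x \<in> X \<Longrightarrow> L k x \<le> g x"
    "\<And>x. x \<in> X \<Longrightarrow> (\<lambda>k. L k x) \<longlonglongrightarrow> g x"
    by (rule lsc_on_continuous_approx[OF assms]) (assumption | rule that)+
  show ?thesis
    by (rule borel_measurable_LIMSEQ_metric[of L])
       (auto intro: borel_measurable_continuous_on_restrict L simp: space_restrict_space)
qed

text \<open>Each continuous minorant passes to the weak limit with the bound intact; dominated
  convergence then climbs back to \<open>g\<close>. The bound \<open>e n\<close> may vary, which
  serves both a fixed \<open>\<eta>\<close> and a sequence tending to 0.\<close>

lemma integral_lsc_le_weak_limit:
  fixes g :: "'a::metric_space \<Rightarrow> real"
  assumes "compact X" and lsc: "lsc_on X g" and nn: "\<And>x. x \<in> X \<Longrightarrow> 0 \<le> g x" and bd: "bounded (g ` X)"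
    and \<mu>s: "\<And>n. borel_prob_on X (\<mu>s n)" and \<mu>: "borel_prob_on X \<mu>" and wc: "weak_conv_on X \<mu>s \<mu>"
    and le: "\<And>n. integral\<^sup>L (\<mu>s n) g \<le> e n" and e: "e \<longlonglongrightarrow> \<eta>"
  shows "integral\<^sup>L \<mu> g \<le> \<eta>"
proof -
  obtain L :: "nat \<Rightarrow> 'a \<Rightarrow> real" where L: "\<And>k. continuous_on X (L k)" "\<And>k x. x \<in> X \<Longrightarrow> 0 \<le> L k x"
     "\<And>k x. x \<in> X \<Longrightarrow> L k x \<le> g x" "\<And>x. x \<in> X \<Longrightarrow> (\<lambda>k. L k x) \<longlonglongrightarrow> g x"
    by (rule lsc_on_continuous_approx[OF lsc nn]) (assumption | rule that)+
  obtain B where B: "\<And>x. x \<in> X \<Longrightarrow> \<bar>g x\<bar> \<le> B" using bd by (auto simp: bounded_iff)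
  have gm: "g \<in> borel_measurable (restrict_space borel X)" using lsc nn by (rule lsc_on_borel_measurable)
  have sets: "sets \<mu> = sets (restrict_space borel X)" using \<mu> by (simp add: borel_prob_on_def)
  interpret prob_space \<mu> using \<mu> by (simp add: borel_prob_on_def)
  have "integral\<^sup>L \<mu> (L k) \<le> \<eta>" for k
  proof (rule LIMSEQ_le[OF _ e])
    show "(\<lambda>n. integral\<^sup>L (\<mu>s n) (L k)) \<longlonglongrightarrow> integral\<^sup>L \<mu> (L k)"
      using wc L(1) by (simp add: weak_conv_on_def)
    have "integral\<^sup>L (\<mu>s n) (L k) \<le> integral\<^sup>L (\<mu>s n) g" for n
      by (rule integral_mono[OF borel_prob_on_integrable_continuous[OF \<open>compact X\<close> \<mu>s L(1)]
            borel_prob_on_integrable[OF \<mu>s gm B]])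
         (use L(3) borel_prob_on_space[OF \<mu>s] in auto)
    then show "\<exists>N. \<forall>n\<ge>N. integral\<^sup>L (\<mu>s n) (L k) \<le> e n" using le order_trans by blast
  qed
  moreover have "(\<lambda>k. integral\<^sup>L \<mu> (L k)) \<longlonglongrightarrow> integral\<^sup>L \<mu> g"
  proof (rule integral_dominated_convergence[where w="\<lambda>_. B"])
    show "g \<in> borel_measurable \<mu>" using gm measurable_cong_sets[OF sets refl] by blast
    show "L k \<in> borel_measurable \<mu>" for k
      using L(1) sets by (rule continuous_on_borel_measurable_restrict)
    show "AE x in \<mu>. (\<lambda>k. L k x) \<longlonglongrightarrow> g x" 
      using L(4) borel_prob_on_space[OF \<mu>] by (intro AE_I2) auto
    show "AE x in \<mu>. norm (L k x) \<le> B" for k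
    proof (rule AE_I2)
      fix x assume "x \<in> space \<mu>"
      then have "x \<in> X" using borel_prob_on_space[OF \<mu>] by simp
      then show "norm (L k x) \<le> B" using L(2,3)[of x k] B[of x] by simp
    qed
  qed simp
  ultimately show ?thesis by (blast intro: LIMSEQ_le_const2)
qed

text \<open>The relatively open sets are stable under intersection and generate the Borel sets, and
  their indicators are pointwise limits of the truncated functions
  \<open>min 1 (k * infdist x (- U))\<close>.\<close>

lemma borel_prob_on_eqI:
  fixes X :: "'a::metric_space set"
  assumes "compact X" and \<mu>: "borel_prob_on X \<mu>" and \<nu>: "borel_prob_on X \<nu>"
    and eq: "\<And>g::'a \<Rightarrow> real. continuous_on X g \<Longrightarrow> integral\<^sup>L \<mu> g = integral\<^sup>L \<nu> g"
  shows "\<mu> = \<nu>"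
proof -
  have sets: "sets \<mu> = sets (restrict_space borel X)" "sets \<nu> = sets (restrict_space borel X)"
    using \<mu> \<nu> by (auto simp: borel_prob_on_def)
  interpret \<mu>: prob_space \<mu> using \<mu> by (simp add: borel_prob_on_def)
  interpret \<nu>: prob_space \<nu> using \<nu> by (simp add: borel_prob_on_def)
  have Xb: "X \<in> sets borel" using compact_imp_closed[OF \<open>compact X\<close>] by simp
  let ?E = "(\<inter>) X ` {U. open U}"
  have gen: "sets (restrict_space borel X) = sigma_sets X ?E"
    unfolding sets_restrict_space borel_def
    by (subst sets_measure_of, simp, subst sigma_sets_Int) (use Xb in \<open>auto simp: borel_def\<close>)
  \<comment> \<open>The case \<open>U = UNIV\<close> is kept apart because the distance to the empty
    set is 0 by convention, which would make every approximant vanish.\<close>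
  have lim: "(\<lambda>k. integral\<^sup>L \<rho> (\<lambda>x. min 1 (real k * infdist x (- U)))) \<longlonglongrightarrow> measure \<rho> (X \<inter> U)"
    if \<rho>: "borel_prob_on X \<rho>" and U: "open U" "U \<noteq> UNIV" for \<rho> U
  proof -
    interpret \<rho>: prob_space \<rho> using \<rho> by (simp add: borel_prob_on_def)
    have srho: "sets \<rho> = sets (restrict_space borel X)" using \<rho> by (simp add: borel_prob_on_def)
    have XU: "X \<inter> U \<in> sets \<rho>" unfolding srho using U(1) by (auto simp: sets_restrict_space)
    have "(\<lambda>k. integral\<^sup>L \<rho> (\<lambda>x. min 1 (real k * infdist x (- U)))) \<longlonglongrightarrow> integral\<^sup>L \<rho> (indicator (X \<inter> U))"
    proof (rule integral_dominated_convergence[where w="\<lambda>_. 1"])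
      show "(indicator (X \<inter> U) :: _ \<Rightarrow> real) \<in> borel_measurable \<rho>" using XU by simp
      show "(\<lambda>x. min 1 (real k * infdist x (- U))) \<in> borel_measurable \<rho>" for k
        by (rule continuous_on_borel_measurable_restrict[OF _ srho]) (intro continuous_intros)
      show "AE x in \<rho>. (\<lambda>k. min 1 (real k * infdist x (- U))) \<longlonglongrightarrow> indicator (X \<inter> U) x"
      proof (rule AE_I2)
        fix x assume "x \<in> space \<rho>"
        then have "x \<in> X" using borel_prob_on_space[OF \<rho>] by simp
        show "(\<lambda>k. min 1 (real k * infdist x (- U))) \<longlonglongrightarrow> indicator (X \<inter> U) x"
        proof (cases "x \<in> U")
          case False
          then show ?thesis by simp
        next
          case True
          then have pos: "infdist x (- U) > 0"
            using in_closed_iff_infdist_zero[of "-U" x] U infdist_nonneg[of x "-U"] by force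
          obtain N :: nat where N: "1 / infdist x (- U) < N" using reals_Archimedean2 by blast
          have "min 1 (real k * infdist x (- U)) = indicator (X \<inter> U) x" if "k \<ge> N" for k
          proof -
            have "1 / infdist x (- U) < k" using N that by (metis less_le_trans of_nat_le_iff)
            then have "1 < k * infdist x (- U)" using pos by (simp add: field_simps)
            then show ?thesis using True \<open>x \<in> X\<close> by simp
          qed
          then show ?thesis using eventually_sequentially by (intro tendsto_eventually) blast
        qed
      qed
    qed (auto simp: infdist_nonneg)
    then show ?thesis using XU by simp
  qed
  have eqU: "emeasure \<mu> (X \<inter> U) = emeasure \<nu> (X \<inter> U)" if "open U" for U
  proof (cases "U = UNIV")
    case True
    then show ?thesis
      using \<mu>.emeasure_space_1 \<nu>.emeasure_space_1 borel_prob_on_space[OF \<mu>] borel_prob_on_space[OF \<nu>] by simp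
  next
    case False
    have "integral\<^sup>L \<mu> (\<lambda>x. min 1 (real k * infdist x (- U))) = integral\<^sup>L \<nu> (\<lambda>x. min 1 (real k * infdist x (- U)))" for k
      by (rule eq) (intro continuous_intros)
    then have "measure \<mu> (X \<inter> U) = measure \<nu> (X \<inter> U)"
      using lim[OF \<mu> that False] lim[OF \<nu> that False] by (simp add: LIMSEQ_unique)
    then show ?thesis by (simp add: \<mu>.emeasure_eq_measure \<nu>.emeasure_eq_measure)
  qed
  show ?thesis
  proof (rule measure_eqI_generator_eq[of ?E X _ _ "\<lambda>_. X"])
    show "Int_stable ?E"
    proof (rule Int_stableI)
      fix a b assume "a \<in> ?E" "b \<in> ?E"
      then obtain U V where "a = X \<inter> U" "b = X \<inter> V" "open U" "open V" by auto
      then have "a \<inter> b = X \<inter> (U \<inter> V)" "open (U \<inter> V)" by auto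
      then show "a \<inter> b \<in> ?E" by blast
    qed
    show "range (\<lambda>_. X) \<subseteq> ?E" using image_eqI[of X "(\<inter>) X" UNIV] by auto
  qed (use eqU sets gen in auto)
qed

section \<open>Continuity sets and partitions\<close>

text \<open>On a compact \<open>X\<close> these are the \<open>\<mu>\<close>-continuity sets. Sandwiching by continuous functions avoids frontiers relative
  to \<open>X\<close> and makes stability under preimages by the flow immediate.\<close>
definition jordan_set :: "'a::topological_space set \<Rightarrow> 'a measure \<Rightarrow> 'a set \<Rightarrow> bool" where
  "jordan_set X \<mu> A \<longleftrightarrow> A \<in> sets \<mu> \<and> (\<forall>e>0. \<exists>g h :: 'a \<Rightarrow> real. continuous_on X g \<and> continuous_on X h \<and>
     (\<forall>x\<in>X. g x \<le> indicator A x \<and> indicator A x \<le> h x) \<and> (\<integral>x. h x - g x \<partial>\<mu>) < e)"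

lemma jordan_setD:
  assumes "jordan_set X \<mu> A" "0 < e"
  obtains g h :: "'a::topological_space \<Rightarrow> real" where "continuous_on X g" "continuous_on X h"
    "\<And>x. x \<in> X \<Longrightarrow> g x \<le> indicator A x" "\<And>x. x \<in> X \<Longrightarrow> indicator A x \<le> h x" "(\<integral>x. h x - g x \<partial>\<mu>) < e"
  using assms unfolding jordan_set_def by metis

lemma jordan_setI:
  assumes "A \<in> sets \<mu>"
    and "\<And>e. 0 < e \<Longrightarrow> \<exists>g h :: 'a::topological_space \<Rightarrow> real. continuous_on X g \<and> continuous_on X h \<and>
     (\<forall>x\<in>X. g x \<le> indicator A x \<and> indicator A x \<le> h x) \<and> (\<integral>x. h x - g x \<partial>\<mu>) < e"
  shows "jordan_set X \<mu> A"
  using assms unfolding jordan_set_def by blast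

lemma integral_indicator_bounds:
  fixes g h :: "'a::topological_space \<Rightarrow> real"
  assumes "compact X" "borel_prob_on X \<mu>" "A \<in> sets \<mu>" "continuous_on X g" "continuous_on X h"
    "\<And>x. x \<in> X \<Longrightarrow> g x \<le> indicator A x" "\<And>x. x \<in> X \<Longrightarrow> indicator A x \<le> h x"
  shows "integral\<^sup>L \<mu> g \<le> measure \<mu> A" "measure \<mu> A \<le> integral\<^sup>L \<mu> h"
proof -
  interpret prob_space \<mu> using assms(2) by (simp add: borel_prob_on_def)
  have int: "integrable \<mu> (indicator A :: _ \<Rightarrow> real)" 
    using assms(3) by (intro integrable_real_indicator) (auto simp: emeasure_eq_measure)
  have m: "measure \<mu> A = integral\<^sup>L \<mu> (indicator A)" using assms(3) by simp
  note intc = borel_prob_on_integrable_continuous[OF assms(1,2)]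
  have sp: "space \<mu> = X" using assms(2) by (rule borel_prob_on_space)
  show "integral\<^sup>L \<mu> g \<le> measure \<mu> A"
    unfolding m by (rule integral_mono[OF intc[OF assms(4)] int]) (simp add: sp assms(6))
  show "measure \<mu> A \<le> integral\<^sup>L \<mu> h"
    unfolding m by (rule integral_mono[OF int intc[OF assms(5)]]) (simp add: sp assms(7))
qed

text \<open>The sandwiching functions squeeze: their integrals converge, and for the limit measure
  they lie within \<open>e\<close> of the measure of \<open>A\<close>.\<close>

lemma tendsto_measure_jordan_set:
  assumes "compact X" and \<mu>s: "\<And>n. borel_prob_on X (\<mu>s n)" and \<mu>: "borel_prob_on X \<mu>"
    and wc: "weak_conv_on X \<mu>s \<mu>" and A: "jordan_set X \<mu> A"
  shows "(\<lambda>n. measure (\<mu>s n) A) \<longlonglongrightarrow> measure \<mu> A"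
proof -
  have A\<mu>: "A \<in> sets \<mu>" and As: "A \<in> sets (\<mu>s n)" for n
    using A \<mu> \<mu>s[of n] by (auto simp: jordan_set_def borel_prob_on_def)
  note bnd = integral_indicator_bounds[OF \<open>compact X\<close> \<mu> A\<mu>]
  note bnds = integral_indicator_bounds[OF \<open>compact X\<close> \<mu>s As]
  have close: "\<exists>g h :: _ \<Rightarrow> real. (\<forall>n. integral\<^sup>L (\<mu>s n) g \<le> measure (\<mu>s n) A \<and> measure (\<mu>s n) A \<le> integral\<^sup>L (\<mu>s n) h) \<and>
     (\<lambda>n. integral\<^sup>L (\<mu>s n) g) \<longlonglongrightarrow> integral\<^sup>L \<mu> g \<and> (\<lambda>n. integral\<^sup>L (\<mu>s n) h) \<longlonglongrightarrow> integral\<^sup>L \<mu> h \<and>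
     measure \<mu> A - e < integral\<^sup>L \<mu> g \<and> integral\<^sup>L \<mu> h < measure \<mu> A + e" if e: "0 < e" for e
  proof -
    obtain g h :: "_ \<Rightarrow> real" where gh: "continuous_on X g" "continuous_on X h"
      "\<And>x. x \<in> X \<Longrightarrow> g x \<le> indicator A x" "\<And>x. x \<in> X \<Longrightarrow> indicator A x \<le> h x" "(\<integral>x. h x - g x \<partial>\<mu>) < e"
      by (rule jordan_setD[OF A e]) (assumption | rule that)+
    have "(\<integral>x. h x - g x \<partial>\<mu>) = integral\<^sup>L \<mu> h - integral\<^sup>L \<mu> g"
      by (intro Bochner_Integration.integral_diff borel_prob_on_integrable_continuous[OF \<open>compact X\<close> \<mu>] gh)
    then show ?thesis
      using bnd[OF gh(1-4)] bnds[OF gh(1-4)] gh(5) wc gh(1,2)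
      by (intro exI[of _ g] exI[of _ h]) (auto simp: weak_conv_on_def)
  qed
  show ?thesis
  proof (rule order_tendstoI)
    fix a assume "a < measure \<mu> A"
    then obtain g where g: "\<And>n. integral\<^sup>L (\<mu>s n) g \<le> measure (\<mu>s n) A"
      "(\<lambda>n. integral\<^sup>L (\<mu>s n) g) \<longlonglongrightarrow> integral\<^sup>L \<mu> g" "a < integral\<^sup>L \<mu> g"
      using close[of "measure \<mu> A - a"] by auto
    from order_tendstoD(1)[OF g(2,3)] show "\<forall>\<^sub>F n in sequentially. a < measure (\<mu>s n) A"
      by eventually_elim (rule less_le_trans[OF _ g(1)])
  next
    fix a assume "measure \<mu> A < a"
    then obtain h where h: "\<And>n. measure (\<mu>s n) A \<le> integral\<^sup>L (\<mu>s n) h"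
      "(\<lambda>n. integral\<^sup>L (\<mu>s n) h) \<longlonglongrightarrow> integral\<^sup>L \<mu> h" "integral\<^sup>L \<mu> h < a"
      using close[of "a - measure \<mu> A"] by auto
    from order_tendstoD(2)[OF h(2,3)] show "\<forall>\<^sub>F n in sequentially. measure (\<mu>s n) A < a"
      by eventually_elim (rule le_less_trans[OF h(1)])
  qed
qed

lemma jordan_set_space:
  assumes "borel_prob_on X \<mu>"
  shows "jordan_set X \<mu> X"
proof (rule jordan_setI)
  show "X \<in> sets \<mu>" using borel_prob_on_space[OF assms] sets.top[of \<mu>] by simp
  show "\<exists>g h. continuous_on X g \<and> continuous_on X h \<and>
     (\<forall>x\<in>X. g x \<le> indicator X x \<and> indicator X x \<le> h x) \<and> (\<integral>x. h x - g x \<partial>\<mu>) < e" if "0 < e" for e :: real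
    using that by (intro exI[of _ "\<lambda>_. 1"]) simp
qed

lemma jordan_set_compl:
  assumes "borel_prob_on X \<mu>" and A: "jordan_set X \<mu> A"
  shows "jordan_set X \<mu> (X - A)"
proof (rule jordan_setI)
  show "X - A \<in> sets \<mu>"
    using A borel_prob_on_space[OF assms(1)] sets.compl_sets[of A \<mu>] by (simp add: jordan_set_def)
  fix e :: real assume e: "0 < e"
  obtain g h :: "_ \<Rightarrow> real" where gh: "continuous_on X g" "continuous_on X h"
    "\<And>x. x \<in> X \<Longrightarrow> g x \<le> indicator A x" "\<And>x. x \<in> X \<Longrightarrow> indicator A x \<le> h x" "(\<integral>x. h x - g x \<partial>\<mu>) < e"
    by (rule jordan_setD[OF A e]) (assumption | rule that)+
  have "indicator (X - A) x = (1 - indicator A x :: real)" if "x \<in> X" for x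
    using that by (auto simp: indicator_def)
  then show "\<exists>g h. continuous_on X g \<and> continuous_on X h \<and>
     (\<forall>x\<in>X. g x \<le> indicator (X - A) x \<and> indicator (X - A) x \<le> h x) \<and> (\<integral>x. h x - g x \<partial>\<mu>) < e"
    using gh by (intro exI[of _ "\<lambda>x. 1 - h x"] exI[of _ "\<lambda>x. 1 - g x"]) (auto intro!: continuous_intros)
qed

lemma jordan_set_Int:
  assumes "compact X" "borel_prob_on X \<mu>" and A: "jordan_set X \<mu> A" and B: "jordan_set X \<mu> B"
  shows "jordan_set X \<mu> (A \<inter> B)"
proof (rule jordan_setI)
  show "A \<inter> B \<in> sets \<mu>" using A B by (auto simp: jordan_set_def)
  fix e :: real assume e: "0 < e"
  then have e2: "0 < e / 2" by simp
  obtain g h :: "_ \<Rightarrow> real" where gh: "continuous_on X g" "continuous_on X h"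
    "\<And>x. x \<in> X \<Longrightarrow> g x \<le> indicator A x" "\<And>x. x \<in> X \<Longrightarrow> indicator A x \<le> h x" "(\<integral>x. h x - g x \<partial>\<mu>) < e / 2"
    by (rule jordan_setD[OF A e2]) (assumption | rule that)+
  obtain g' h' :: "_ \<Rightarrow> real" where gh': "continuous_on X g'" "continuous_on X h'"
    "\<And>x. x \<in> X \<Longrightarrow> g' x \<le> indicator B x" "\<And>x. x \<in> X \<Longrightarrow> indicator B x \<le> h' x" "(\<integral>x. h' x - g' x \<partial>\<mu>) < e / 2"
    by (rule jordan_setD[OF B e2]) (assumption | rule that)+
  let ?g = "\<lambda>x. min (g x) (g' x)" and ?h = "\<lambda>x. min (h x) (h' x)"
  note int = borel_prob_on_integrable_continuous[OF assms(1,2)]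
  have c: "continuous_on X ?g" "continuous_on X ?h" using gh gh' by (auto intro!: continuous_intros)
  \<comment> \<open>Minima rather than products, because the lower functions may be negative. Both
    gaps are nonnegative, so the gap between the minima is at most their sum.\<close>
  have "(\<integral>x. ?h x - ?g x \<partial>\<mu>) \<le> (\<integral>x. (h x - g x) + (h' x - g' x) \<partial>\<mu>)"
  proof (rule integral_mono)
    show "integrable \<mu> (\<lambda>x. ?h x - ?g x)" "integrable \<mu> (\<lambda>x. (h x - g x) + (h' x - g' x))"
      using gh gh' by (auto intro!: int continuous_intros)
    fix x assume "x \<in> space \<mu>"
    then have "x \<in> X" using borel_prob_on_space[OF assms(2)] by simp
    then show "?h x - ?g x \<le> (h x - g x) + (h' x - g' x)"
      using gh(3,4)[of x] gh'(3,4)[of x] by (simp add: min_def)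
  qed
  also have "\<dots> = (\<integral>x. h x - g x \<partial>\<mu>) + (\<integral>x. h' x - g' x \<partial>\<mu>)"
    using gh gh' by (intro Bochner_Integration.integral_add) (auto intro!: int continuous_intros)
  also have "\<dots> < e" using gh(5) gh'(5) by simp
  finally have "(\<integral>x. ?h x - ?g x \<partial>\<mu>) < e" .
  moreover have "?g x \<le> indicator (A \<inter> B) x \<and> indicator (A \<inter> B) x \<le> ?h x" if "x \<in> X" for x
    using gh(3,4)[OF that] gh'(3,4)[OF that] by (cases "x \<in> A"; cases "x \<in> B") (auto simp: min_def)
  ultimately show "\<exists>g h. continuous_on X g \<and> continuous_on X h \<and>
     (\<forall>x\<in>X. g x \<le> indicator (A \<inter> B) x \<and> indicator (A \<inter> B) x \<le> h x) \<and> (\<integral>x. h x - g x \<partial>\<mu>) < e"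
    using c by (intro exI[of _ ?g] exI[of _ ?h]) auto
qed

lemma jordan_set_diff_Union:
  fixes n :: nat
  assumes "compact X" "borel_prob_on X \<mu>" "jordan_set X \<mu> A" "\<And>j. j < n \<Longrightarrow> jordan_set X \<mu> (B j)"
  shows "jordan_set X \<mu> (A - (\<Union>j<n. B j))"
  using assms(4)
proof (induction n)
  case 0
  then show ?case using assms(3) by simp
next
  case (Suc n)
  have "A \<subseteq> X"
    using assms(3) sets.sets_into_space[of A \<mu>] borel_prob_on_space[OF assms(2)] by (simp add: jordan_set_def)
  then have "A - (\<Union>j<Suc n. B j) = (A - (\<Union>j<n. B j)) \<inter> (X - B n)" by (auto simp: less_Suc_eq)
  then show ?case
    using Suc jordan_set_Int[OF assms(1,2)] jordan_set_compl[OF assms(2)] by simp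
qed

text \<open>Only countably many spheres about \<open>c\<close> have positive measure.\<close>
lemma jordan_set_ball:
  fixes X :: "'a::metric_space set"
  assumes "compact X" and \<mu>: "borel_prob_on X \<mu>" and a: "0 < a"
  obtains r where "0 < r" "r < a" "jordan_set X \<mu> (X \<inter> ball c r)"
proof -
  interpret prob_space \<mu> using \<mu> by (simp add: borel_prob_on_def)
  have sets: "sets \<mu> = sets (restrict_space borel X)" using \<mu> by (simp add: borel_prob_on_def)
  have sp: "space \<mu> = X" using \<mu> by (rule borel_prob_on_space)
  have dm[measurable]: "dist c \<in> borel_measurable \<mu>"
    by (rule continuous_on_borel_measurable_restrict[OF _ sets]) (intro continuous_intros)
  interpret N: prob_space "distr \<mu> borel (dist c)" by (rule prob_space_distr[OF dm])
  have "countable {r. measure (distr \<mu> borel (dist c)) {r} \<noteq> 0}" by (rule N.countable_support)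
  moreover have "uncountable {0<..<a}" using a by (simp add: uncountable_open_interval)
  ultimately obtain r where r: "0 < r" "r < a" "measure (distr \<mu> borel (dist c)) {r} = 0"
    using countable_subset[of "{0<..<a}"] by (metis (mono_tags, lifting) greaterThanLessThan_iff mem_Collect_eq subsetI)
  have "emeasure \<mu> {x \<in> space \<mu>. dist c x = r} = 0"
  proof -
    have "dist c -` {r} \<inter> space \<mu> = {x \<in> space \<mu>. dist c x = r}" by auto
    then show ?thesis using r(3) by (simp add: measure_distr emeasure_eq_measure)
  qed
  then have ae: "AE x in \<mu>. dist c x \<noteq> r"
    by (intro AE_I[of _ _ "{x \<in> space \<mu>. dist c x = r}"]) auto
  \<comment> \<open>Linear ramps of width \<open>1 / n\<close> just outside and just inside the
    sphere. Away from the sphere they eventually coincide, and the sphere is a null set.\<close>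
  define h where "h n x = max 0 (min 1 (1 - real n * (dist c x - r)))" for n x
  define g where "g n x = max 0 (min 1 (real n * (r - dist c x)))" for n x
  have cont: "continuous_on X (h n)" "continuous_on X (g n)" for n
    unfolding h_def[abs_def] g_def[abs_def] by (intro continuous_intros)+
  have bnd: "g n x \<le> indicator (X \<inter> ball c r) x" "indicator (X \<inter> ball c r) x \<le> h n x" if "x \<in> X" for n x
  proof -
    have "real n * (r - dist c x) \<le> 0" if "dist c x \<ge> r"
      using that by (intro mult_nonneg_nonpos) auto
    moreover have "real n * (dist c x - r) \<le> 0" if "dist c x < r"
      using that by (intro mult_nonneg_nonpos) auto
    ultimately show "g n x \<le> indicator (X \<inter> ball c r) x" "indicator (X \<inter> ball c r) x \<le> h n x"
      using \<open>x \<in> X\<close> by (auto simp: g_def h_def indicator_def)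
  qed
  have "(\<lambda>n. \<integral>x. h n x - g n x \<partial>\<mu>) \<longlonglongrightarrow> (\<integral>x. 0 \<partial>\<mu>)"
  proof (rule integral_dominated_convergence[where w="\<lambda>_. 1"])
    show "(\<lambda>x. h n x - g n x) \<in> borel_measurable \<mu>" for n
      using continuous_on_borel_measurable_restrict[OF cont(1) sets]
        continuous_on_borel_measurable_restrict[OF cont(2) sets] by (rule borel_measurable_diff)
    show "AE x in \<mu>. norm (h n x - g n x) \<le> 1" for n
      by (intro AE_I2) (auto simp: h_def g_def)
    show "AE x in \<mu>. (\<lambda>n. h n x - g n x) \<longlonglongrightarrow> 0"
      using ae
    proof eventually_elim
      case (elim x)
      then have pos: "0 < \<bar>dist c x - r\<bar>" by simp
      obtain N :: nat where N: "1 / \<bar>dist c x - r\<bar> < N" using reals_Archimedean2 by blast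
      have "h n x - g n x = 0" if "n \<ge> N" for n
      proof -
        have "1 / \<bar>dist c x - r\<bar> < n" using N that by (metis less_le_trans of_nat_le_iff)
        then have "1 < n * \<bar>dist c x - r\<bar>" using pos by (simp add: field_simps)
        then show ?thesis by (auto simp: h_def g_def abs_if algebra_simps split: if_splits)
      qed
      then show ?case using eventually_sequentially by (intro tendsto_eventually) blast
    qed
  qed auto
  then have small: "\<exists>n. (\<integral>x. h n x - g n x \<partial>\<mu>) < e" if "0 < e" for e
    using order_tendstoD(2)[of _ "0::real" sequentially e] that eventually_sequentially by fastforce
  have "jordan_set X \<mu> (X \<inter> ball c r)"
  proof (rule jordan_setI)
    show "X \<inter> ball c r \<in> sets \<mu>" unfolding sets by (auto simp: sets_restrict_space)
    fix e :: real assume "0 < e"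
    then obtain n where "(\<integral>x. h n x - g n x \<partial>\<mu>) < e" using small by blast
    then show "\<exists>g h. continuous_on X g \<and> continuous_on X h \<and>
     (\<forall>x\<in>X. g x \<le> indicator (X \<inter> ball c r) x \<and> indicator (X \<inter> ball c r) x \<le> h x) \<and> (\<integral>x. h x - g x \<partial>\<mu>) < e"
      using cont bnd by (intro exI[of _ "g n"] exI[of _ "h n"]) auto
  qed
  with r that show ?thesis by blast
qed

text \<open>Finitely many balls of radius below \<open>d / 2\<close> with null boundary spheres
  cover \<open>X\<close>; the label is the index of the first ball containing the point. Each cell
  is a ball minus the earlier ones, and such differences remain continuity sets.\<close>

lemma jordan_labelling:
  fixes X :: "'a::metric_space set"
  assumes "compact X" and \<mu>: "borel_prob_on X \<mu>" and "0 < d"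
  obtains lab :: "'a \<Rightarrow> nat" and k where "\<And>x. lab x < k"
    "\<And>x y. x \<in> X \<Longrightarrow> y \<in> X \<Longrightarrow> lab x = lab y \<Longrightarrow> dist x y < d"
    "\<And>i. jordan_set X \<mu> {x\<in>X. lab x = i}"
proof -
  have "\<exists>r. 0 < r \<and> r < d / 2 \<and> jordan_set X \<mu> (X \<inter> ball c r)" for c
    using jordan_set_ball[OF assms(1,2), of "d/2" c] \<open>0 < d\<close> by (metis half_gt_zero)
  then obtain r where r: "\<And>c. 0 < r c" "\<And>c. r c < d / 2" "\<And>c. jordan_set X \<mu> (X \<inter> ball c (r c))" by metis
  obtain C where C: "C \<subseteq> X" "finite C" "X \<subseteq> (\<Union>c\<in>C. ball c (r c))"
  proof (rule compactE_image[OF \<open>compact X\<close>, of X "\<lambda>c. ball c (r c)"])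
    show "X \<subseteq> (\<Union>c\<in>X. ball c (r c))" using r(1) by force
  qed auto
  obtain cs where cs: "set cs = C" using finite_list[OF C(2)] by blast
  define B where "B i = X \<inter> ball (cs ! i) (r (cs ! i))" for i
  define lab where "lab x = (if x \<in> X then LEAST i. x \<in> B i \<and> i < length cs else 0)" for x
  have ex: "\<exists>i. x \<in> B i \<and> i < length cs" if x: "x \<in> X" for x
  proof -
    obtain c where "c \<in> C" "x \<in> ball c (r c)" using C(3) x by auto
    then show ?thesis using x by (auto simp: B_def cs[symmetric] in_set_conv_nth)
  qed
  have lab: "x \<in> B (lab x)" "lab x < length cs" if "x \<in> X" for x
    using LeastI_ex[OF ex[OF that]] that by (auto simp: lab_def)
  have lab_eq: "lab x = i \<longleftrightarrow> x \<in> B i \<and> (\<forall>j<i. x \<notin> B j)" if "x \<in> X" "i < length cs" for x i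
  proof
    assume "lab x = i"
    then show "x \<in> B i \<and> (\<forall>j<i. x \<notin> B j)"
      using lab[OF that(1)] not_less_Least[of _ "\<lambda>i. x \<in> B i \<and> i < length cs"] that by (auto simp: lab_def)
  next
    assume *: "x \<in> B i \<and> (\<forall>j<i. x \<notin> B j)"
    have "(LEAST i. x \<in> B i \<and> i < length cs) = i"
      by (rule Least_equality) (use * that in \<open>auto simp: not_less[symmetric]\<close>)
    then show "lab x = i" using that by (simp add: lab_def)
  qed
  have J: "jordan_set X \<mu> (B i)" for i unfolding B_def by (rule r(3))
  show ?thesis
  \<comment> \<open>One more than the number of balls: the default label 0 of points outside
    \<open>X\<close> must stay below the bound whatever the cover is.\<close>
  proof (rule that[of lab "Suc (length cs)"])
    show "lab x < Suc (length cs)" for x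
      using lab(2)[of x] by (cases "x \<in> X") (auto simp: lab_def less_Suc_eq)
    show "dist x y < d" if "x \<in> X" "y \<in> X" "lab x = lab y" for x y
    proof -
      let ?c = "cs ! lab x"
      have "dist ?c x < d / 2" "dist ?c y < d / 2"
        using lab(1)[OF that(1)] lab(1)[OF that(2)] that(3) r(2)[of ?c] by (auto simp: B_def)
      then show ?thesis using dist_triangle_half_r[of ?c x d y] by simp
    qed
    show "jordan_set X \<mu> {x\<in>X. lab x = i}" for i
    proof (cases "i < length cs")
      case True
      have "B i \<subseteq> X" by (auto simp: B_def)
      then have "{x\<in>X. lab x = i} = B i - (\<Union>j<i. B j)" using lab_eq[OF _ True] by blast
      then show ?thesis using jordan_set_diff_Union[OF assms(1,2) J J] by simp
    next
      case False
      then have "{x\<in>X. lab x = i} = X - X" using lab(2) by auto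
      then show ?thesis using jordan_set_compl[OF \<mu> jordan_set_space[OF \<mu>]] by (simp only:)
    qed
  qed
qed

section \<open>Flow averages\<close>

text \<open>\<open>Birkhoff_int\<close> is a gauge integral, while measures integrate in the sense
  of Bochner. For bounded Borel integrands on an interval both exist and agree, and all integrands
  along orbits below are of this kind.\<close>

lemma bounded_borel_integrable_on:
  fixes h :: "real \<Rightarrow> real"
  assumes "h \<in> borel_measurable borel" "\<And>s. \<bar>h s\<bar> \<le> B"
  shows "set_integrable lborel {a..b} h" "h integrable_on {a..b}"
proof -
  show "set_integrable lborel {a..b} h"
    unfolding set_integrable_def
    by (rule integrableI_bounded_set_indicator[where B=B]) (use assms in \<open>auto simp: emeasure_lborel_Icc_eq\<close>)
  then show "h integrable_on {a..b}" by (rule set_borel_integral_eq_integral)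
qed

lemma integral_uniform_measure_Icc:
  fixes h :: "real \<Rightarrow> real"
  assumes h: "h \<in> borel_measurable borel" "\<And>s. \<bar>h s\<bar> \<le> B" and t: "0 < t"
  shows "integral\<^sup>L (uniform_measure lborel {0..t}) h = integral {0..t} h / t"
proof -
  have "uniform_measure lborel {0..t} = density lborel (\<lambda>s. ennreal (indicator {0..t} s / t))"
    unfolding uniform_measure_def using t
    by (intro arg_cong2[where f=density] refl ext)
       (auto simp: indicator_def divide_ennreal[symmetric] simp del: divide_ennreal)
  then have "integral\<^sup>L (uniform_measure lborel {0..t}) h = (\<integral>s. (indicator {0..t} s / t) *\<^sub>R h s \<partial>lborel)"
    using h t by (simp add: integral_density)
  also have "\<dots> = (\<integral>s. (indicator {0..t} s *\<^sub>R h s) / t \<partial>lborel)"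
    by (intro Bochner_Integration.integral_cong) auto
  also have "\<dots> = (LINT s:{0..t}|lborel. h s) / t"
    unfolding set_lebesgue_integral_def by (rule integral_divide_zero)
  also have "\<dots> = integral {0..t} h / t"
    using set_borel_integral_eq_integral(2)[OF bounded_borel_integrable_on(1)[OF h]] by simp
  finally show ?thesis .
qed

text \<open>The right-hand side is the tangent at \<open>a\<close> of the concave function
  \<open>- u * ln u\<close>. Being affine in \<open>u\<close>, it can be integrated
  directly.\<close>

lemma minus_mult_ln_le_tangent:
  fixes u a :: real
  assumes "0 \<le> u" "0 < a"
  shows "- u * ln u \<le> - u * ln a + a - u"
proof (cases "u = 0")
  case False
  with assms have u: "u > 0" by simp
  have "ln (a / u) \<le> a / u - 1" using u assms by (intro ln_le_minus_one) simp
  then have "u * (ln a - ln u) \<le> u * (a / u - 1)" using u assms by (intro mult_left_mono) (auto simp: ln_div)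
  then show ?thesis using u by (simp add: algebra_simps)
qed (use assms in simp)

lemma abs_minus_mult_ln_le_one: "\<bar>- u * ln u\<bar> \<le> 1" if "0 \<le> u" "u \<le> 1" for u :: real
proof -
  have "0 \<le> u * - ln u" using that by (cases "u = 0") (auto intro!: mult_nonneg_nonpos)
  then show ?thesis using minus_mult_ln_le_one[OF that(1)] by simp
qed

text \<open>Jensen's inequality: integrate the tangent taken at the mean \<open>M\<close>.\<close>

lemma integral_minus_mult_ln_le:
  fixes m :: "real \<Rightarrow> real"
  assumes m: "m \<in> borel_measurable borel" "\<And>u. 0 \<le> m u" "\<And>u. m u \<le> 1" and t: "0 < t"
  defines "M \<equiv> integral {0..t} m / t"
  shows "integral {0..t} (\<lambda>u. - m u * ln (m u)) \<le> t * (- M * ln M)"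
proof -
  have im: "m integrable_on {0..t}" by (rule bounded_borel_integrable_on[of _ 1]) (use m in auto)
  have ie: "(\<lambda>u. - m u * ln (m u)) integrable_on {0..t}"
    by (rule bounded_borel_integrable_on[of _ 1]) (use m abs_minus_mult_ln_le_one in auto)
  have M: "integral {0..t} m = t * M" using t by (simp add: M_def)
  have M0: "0 \<le> M" unfolding M_def using t m by (intro divide_nonneg_pos integral_nonneg im) auto
  have key: "integral {0..t} (\<lambda>u. - m u * ln (m u)) \<le> - (t * M) * ln a + t * a - t * M" if a: "0 < a" for a
  proof -
    have i1: "(\<lambda>u. m u * - ln a) integrable_on {0..t}" using im by (rule integrable_on_mult_left)
    have i2: "(\<lambda>u. m u * - ln a + a) integrable_on {0..t}" using i1 by (intro integrable_add) auto
    have "integral {0..t} (\<lambda>u. - m u * ln (m u)) \<le> integral {0..t} (\<lambda>u. (m u * - ln a + a) - m u)"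
      using minus_mult_ln_le_tangent[OF m(2) a] by (intro integral_le ie integrable_diff i2 im) auto
    also have "\<dots> = integral {0..t} (\<lambda>u. m u * - ln a + a) - integral {0..t} m"
      by (rule Henstock_Kurzweil_Integration.integral_diff[OF i2 im])
    also have "integral {0..t} (\<lambda>u. m u * - ln a + a) = integral {0..t} (\<lambda>u. m u * - ln a) + integral {0..t} (\<lambda>u. a)"
      by (rule Henstock_Kurzweil_Integration.integral_add[OF i1]) auto
    also have "integral {0..t} (\<lambda>u. m u * - ln a) = integral {0..t} m * - ln a"
      by (rule integral_mult_left)
    finally show ?thesis using t by (simp add: M)
  qed
  show ?thesis
  proof (cases "M = 0")
    case True
    \<comment> \<open>At \<open>M = 0\<close> the tangent is vertical, so tangents at small positive
      points replace it; with mean 0 the one at \<open>a\<close> costs just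
      \<open>t * a\<close>.\<close>
    have "integral {0..t} (\<lambda>u. - m u * ln (m u)) \<le> 0 + e" if "0 < e" for e
      using key[of "e / t"] that t True by simp
    then have "integral {0..t} (\<lambda>u. - m u * ln (m u)) \<le> 0" by (rule field_le_epsilon)
    then show ?thesis using True by simp
  next
    case False
    then show ?thesis using key[of M] M0 by simp
  qed
qed

text \<open>The translates of \<open>[0, q]\<close> by multiples of \<open>q\<close> tile
  \<open>[0, K q]\<close>. This is how an average over offsets becomes an integral over
  time.\<close>

lemma integral_sum_shifts:
  fixes G :: "real \<Rightarrow> real"
  assumes "\<And>a b. G integrable_on {a..b}" "0 \<le> q"
  shows "integral {0..q} (\<lambda>s. \<Sum>k<K. G (s + real k * q)) = integral {0..real K * q} G"
proof -
  have sh: "(\<lambda>s. G (s + c)) integrable_on {0..q}" "integral {0..q} (\<lambda>s. G (s + c)) = integral {c..c + q} G" for c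
    using integrable_on_shift_Icc_real[of G c 0 q] integral_shift_Icc_real[of 0 q G c] assms(1)
    by (auto simp: comp_def add.commute)
  show ?thesis
  proof (induction K)
    case (Suc K)
    have "integral {0..q} (\<lambda>s. \<Sum>k<Suc K. G (s + real k * q))
      = integral {0..q} (\<lambda>s. \<Sum>k<K. G (s + real k * q)) + integral {0..q} (\<lambda>s. G (s + real K * q))"
      using sh by (simp add: Henstock_Kurzweil_Integration.integral_add integrable_sum)
    also have "\<dots> = integral {0..real K * q} G + integral {real K * q..real K * q + q} G"
      using Suc sh by simp
    also have "\<dots> = integral {0..real K * q + q} G"
      using assms by (intro Henstock_Kurzweil_Integration.integral_combine) auto
    finally show ?case by (simp add: algebra_simps)
  qed simp
qed

section \<open>Empirical measures of a continuous flow\<close>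

locale compact_flow =
  fixes X :: "'a::metric_space set" and f :: "real \<Rightarrow> 'a \<Rightarrow> 'a"
  assumes compact: "compact X" and flow: "continuous_flow X f"
begin

lemma flow_in: "x \<in> X \<Longrightarrow> f s x \<in> X"
  using flow by (auto simp: continuous_flow_def)

lemma flow_zero: "x \<in> X \<Longrightarrow> f 0 x = x"
  using flow by (auto simp: continuous_flow_def)

lemma flow_add: "x \<in> X \<Longrightarrow> f (s + t) x = f s (f t x)"
  using flow by (auto simp: continuous_flow_def)

lemma continuous_on_flow: "continuous_on (UNIV \<times> X) (\<lambda>(t, x). f t x)"
  using flow by (auto simp: continuous_flow_def)

lemma continuous_on_flow_map: "continuous_on X (f s)"
  using continuous_on_compose2[OF continuous_on_flow continuous_on_Pair[OF continuous_on_const continuous_on_id], of s X]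
  by auto

lemma continuous_on_orbit: "x \<in> X \<Longrightarrow> continuous_on UNIV (\<lambda>s. f s x)"
  using continuous_on_compose2[OF continuous_on_flow continuous_on_Pair[OF continuous_on_id continuous_on_const], of x UNIV]
  by auto

lemma flow_map_measurable: "f s \<in> measurable (restrict_space borel X) (restrict_space borel X)"
  by (rule measurable_restrict_space2)
     (auto simp: space_restrict_space flow_in intro: borel_measurable_continuous_on_restrict continuous_on_flow_map)

lemma orbit_measurable: "x \<in> X \<Longrightarrow> (\<lambda>s. f s x) \<in> measurable borel (restrict_space borel X)"
  by (rule measurable_restrict_space2) (auto simp: flow_in intro: borel_measurable_continuous_onI continuous_on_orbit)

text \<open>The image under \<open>(x, s) \<mapsto> f s x\<close> of the weights times the uniform
  law on \<open>[0, t]\<close>. The integral formula is kept for all bounded Borel functions,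
  because it is applied to indicators of cells and to a merely semicontinuous function.\<close>

lemma flow_average_measure:
  assumes E: "finite E" "E \<subseteq> X" and w: "\<And>x. x \<in> E \<Longrightarrow> 0 \<le> w x" "sum w E = 1" and t: "0 < t"
  obtains \<mu> where "borel_prob_on X \<mu>"
    "\<And>g B. g \<in> borel_measurable (restrict_space borel X) \<Longrightarrow> (\<And>x. x \<in> X \<Longrightarrow> \<bar>g x\<bar> \<le> B) \<Longrightarrow>
       integral\<^sup>L \<mu> g = (\<Sum>x\<in>E. w x * Birkhoff_int f g x t) / t"
proof -
  define N where "N = point_measure E (\<lambda>x. ennreal (w x))"
  define U where "U = uniform_measure lborel {0..t}"
  have "prob_space N" unfolding N_def
    by (rule prob_space_point_measure) (use E w in \<open>auto simp: sum_ennreal\<close>)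
  moreover have "prob_space U" unfolding U_def
    by (rule prob_space_uniform_measure) (use t in auto)
  ultimately interpret pair_prob_space N U by (simp add: pair_prob_space_def pair_sigma_finite_def prob_space_imp_sigma_finite)
  let ?F = "\<lambda>(x, s). f s x"
  \<comment> \<open>Since \<open>E\<close> is finite, joint measurability follows from measurability
    of the single orbits.\<close>
  have "?F \<in> measurable (count_space E \<Otimes>\<^sub>M borel) (restrict_space borel X)"
    by (rule measurable_pair_measure_countable1) (use E orbit_measurable in \<open>auto intro: countable_finite\<close>)
  moreover have "sets (N \<Otimes>\<^sub>M U) = sets (count_space E \<Otimes>\<^sub>M borel)"
    by (rule sets_pair_measure_cong) (auto simp: N_def U_def sets_point_measure)
  ultimately have F: "?F \<in> measurable (N \<Otimes>\<^sub>M U) (restrict_space borel X)"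
    using measurable_cong_sets by blast
  define \<mu> where "\<mu> = distr (N \<Otimes>\<^sub>M U) (restrict_space borel X) ?F"
  have "borel_prob_on X \<mu>" using prob_space_distr[OF F] by (simp add: borel_prob_on_def \<mu>_def)
  moreover have "integral\<^sup>L \<mu> g = (\<Sum>x\<in>E. w x * Birkhoff_int f g x t) / t"
    if g: "g \<in> borel_measurable (restrict_space borel X)" and B: "\<And>x. x \<in> X \<Longrightarrow> \<bar>g x\<bar> \<le> B" for g B
  proof -
    have gF: "(\<lambda>z. g (?F z)) \<in> borel_measurable (N \<Otimes>\<^sub>M U)" using measurable_comp[OF F g] by (simp add: comp_def)
    have "integrable (N \<Otimes>\<^sub>M U) (\<lambda>z. g (?F z))"
    proof (rule integrable_const_bound[of _ B, OF AE_I2 gF])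
      fix z assume "z \<in> space (N \<Otimes>\<^sub>M U)"
      then have "?F z \<in> X" using measurable_space[OF F] by (auto simp: space_restrict_space)
      then show "norm (g (?F z)) \<le> B" using B by simp
    qed
    from integral_fst'[OF this] have "integral\<^sup>L (N \<Otimes>\<^sub>M U) (\<lambda>z. g (?F z)) = (\<integral>x. \<integral>s. g (f s x) \<partial>U \<partial>N)" by simp
    also have "\<dots> = (\<Sum>x\<in>E. w x * (\<integral>s. g (f s x) \<partial>U))"
      unfolding N_def by (subst lebesgue_integral_point_measure_finite) (use E w in auto)
    also have "\<dots> = (\<Sum>x\<in>E. w x * (Birkhoff_int f g x t / t))"
    proof (intro sum.cong refl)
      fix x assume "x \<in> E"
      then have x: "x \<in> X" using E by auto
      have "(\<lambda>s. g (f s x)) \<in> borel_measurable borel" using measurable_comp[OF orbit_measurable[OF x] g] by (simp add: comp_def)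
      then show "w x * (\<integral>s. g (f s x) \<partial>U) = w x * (Birkhoff_int f g x t / t)"
        unfolding U_def Birkhoff_int_def using integral_uniform_measure_Icc[OF _ B[OF flow_in[OF x]] t] by simp
    qed
    finally show ?thesis
      unfolding \<mu>_def by (subst integral_distr[OF F g]) (simp add: sum_divide_distrib)
  qed
  ultimately show ?thesis using that by blast
qed

end

lemma measure_point_measure_finite:
  assumes "finite E" "A \<subseteq> E" "\<And>x. x \<in> E \<Longrightarrow> 0 \<le> w x"
  shows "measure (point_measure E (\<lambda>x. ennreal (w x))) A = sum w A"
proof -
  have "emeasure (point_measure E (\<lambda>x. ennreal (w x))) A = (\<Sum>x\<in>A. ennreal (w x))"
    by (rule emeasure_point_measure_finite) (use assms in auto)
  also have "\<dots> = ennreal (sum w A)" by (rule sum_ennreal) (use assms in auto)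
  finally show ?thesis using assms by (simp add: measure_def sum_nonneg subset_iff)
qed

lemma label_entropy_point_measure_inj:
  assumes "finite E" "\<And>x. x \<in> E \<Longrightarrow> 0 \<le> w x" "inj_on c E"
  shows "label_entropy (point_measure E (\<lambda>x. ennreal (w x))) c = (\<Sum>x\<in>E. - w x * ln (w x))"
proof -
  have "{x\<in>E. c x = c y} = {y}" if "y \<in> E" for y using assms(3) that by (auto simp: inj_on_def)
  then show ?thesis
    unfolding label_entropy_def space_point_measure using assms
    by (subst sum.reindex) (auto intro!: sum.cong simp: measure_point_measure_finite)
qed

text \<open>A fibre of an itinerary is a finite intersection of fibres at single times, or empty if
  the word has the wrong length. The predicate is instantiated both with Borel sets and with
  continuity sets.\<close>

lemma itinerary_fibre_induct:
  assumes "P X" "P {}" "\<And>A B. P A \<Longrightarrow> P B \<Longrightarrow> P (A \<inter> B)"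
    "\<And>s i. s \<in> set ts \<Longrightarrow> P {y\<in>X. lab (f s y) = i}"
  shows "P {y\<in>X. itinerary f lab ts y = l}"
  using assms(4)
proof (induction ts arbitrary: l)
  case Nil
  then show ?case using assms(1,2) by (cases "l = []") (auto simp: itinerary_def)
next
  case (Cons s ts)
  show ?case
  proof (cases l)
    case Nil
    then show ?thesis using assms(2) by (simp add: itinerary_def)
  next
    case (Cons a l')
    then have "{y\<in>X. itinerary f lab (s # ts) y = l} = {y\<in>X. lab (f s y) = a} \<inter> {y\<in>X. itinerary f lab ts y = l'}"
      by (auto simp: itinerary_def)
    then show ?thesis using Cons.IH[of l'] Cons.prems assms(3) by simp
  qed
qed

lemma itinerary_in_lists:
  assumes "\<And>x. lab x < k"
  shows "itinerary f lab ts x \<in> {l. set l \<subseteq> {..<k} \<and> length l = length ts}"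
  using assms by (auto simp: itinerary_def)

lemma card_bounded_lists: "finite {l. set l \<subseteq> {..<k} \<and> length l = n}" "card {l. set l \<subseteq> {..<k::nat} \<and> length l = n} = k ^ n"
  using finite_lists_length_eq[of "{..<k}" n] card_lists_length_eq[of "{..<k}" n] by auto

context compact_flow
begin

lemma label_preimage_measurable:
  assumes "{x\<in>X. lab x = i} \<in> sets (restrict_space borel X)"
  shows "{x\<in>X. lab (f s x) = i} \<in> sets (restrict_space borel X)"
proof -
  have "f s -` {x\<in>X. lab x = i} \<inter> space (restrict_space borel X) = {x\<in>X. lab (f s x) = i}"
    using flow_in by (auto simp: space_restrict_space)
  then show ?thesis using measurable_sets[OF flow_map_measurable assms] by metis
qed

lemma itinerary_fibre_measurable:
  assumes "\<And>i. {x\<in>X. lab x = i} \<in> sets (restrict_space borel X)"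
  shows "{x\<in>X. itinerary f lab ts x = l} \<in> sets (restrict_space borel X)"
proof (rule itinerary_fibre_induct[where P="\<lambda>A. A \<in> sets (restrict_space borel X)"])
  show "X \<in> sets (restrict_space borel X)"
    using sets.top[of "restrict_space borel X"] by (simp add: space_restrict_space)
qed (use label_preimage_measurable[OF assms] in auto)

lemma itinerary_shift:
  "x \<in> X \<Longrightarrow> itinerary f lab (map (\<lambda>s. u + s) ts) x = itinerary f lab ts (f u x)"
  by (simp add: itinerary_def flow_add[symmetric] add.commute)

text \<open>Misiurewicz's block argument: for every offset \<open>s\<close> in \<open>[0, q]\<close> the times \<open>s + kq + j\<close> separate \<open>E\<close>
  up to boundary blocks; averaging over \<open>s\<close> turns the block entropies into an integral over \<open>[0, t]\<close>.\<close>
lemma separated_entropy_le: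
  assumes E: "finite E" "E \<subseteq> X" and w: "\<And>x. x \<in> E \<Longrightarrow> 0 \<le> w x" "sum w E = 1"
    and t: "0 < t" and sep: "separated f t \<epsilon> E"
    and lab: "\<And>x. lab x < (k::nat)" "\<And>i. {x\<in>X. lab x = i} \<in> sets (restrict_space borel X)"
    and close: "\<And>x y s. x \<in> X \<Longrightarrow> y \<in> X \<Longrightarrow> lab x = lab y \<Longrightarrow> 0 \<le> s \<Longrightarrow> s \<le> 1 \<Longrightarrow> dist (f s x) (f s y) \<le> \<epsilon>"
    and \<mu>: "borel_prob_on X \<mu>"
      "\<And>g B. g \<in> borel_measurable (restrict_space borel X) \<Longrightarrow> (\<And>x. x \<in> X \<Longrightarrow> \<bar>g x\<bar> \<le> B) \<Longrightarrow>
       integral\<^sup>L \<mu> g = (\<Sum>x\<in>E. w x * Birkhoff_int f g x t) / t"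
    and q: "0 < (q::nat)"
  shows "(\<Sum>x\<in>E. - w x * ln (w x)) / t \<le>
    2 * real (k ^ q) / t + label_entropy \<mu> (itinerary f lab (map real [0..<q])) / q"
proof -
  define N where "N = point_measure E (\<lambda>x. ennreal (w x))"
  interpret N: prob_space N unfolding N_def
    by (rule prob_space_point_measure) (use E w in \<open>auto simp: sum_ennreal\<close>)
  have spN: "space N = E" by (simp add: N_def space_point_measure)
  have sfN: "simple_function N c" for c :: "'a \<Rightarrow> nat" using E by (simp add: N_def)
  define block where "block u = map (\<lambda>s. u + s) (map real [0..<q])" for u :: real
  define G where "G u = label_entropy N (itinerary f lab (block u))" for u
  define H where "H = (\<Sum>x\<in>E. - w x * ln (w x))"
  define K where "K = nat \<lfloor>t / q\<rfloor>"
  define W where "W = {l. set l \<subseteq> {..<k} \<and> length l = q}"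
  have W: "finite W" "card W = k ^ q" unfolding W_def by (rule card_bounded_lists)+
  have rK: "real K \<le> t / q" "t / q < real K + 1"
    using t q by (auto simp: K_def)
  then have Kq: "real K * q \<le> t" "t < real K * q + q"
    using q by (auto simp: field_simps)
  have inW: "itinerary f lab (block u) x \<in> W" for u x
    using itinerary_in_lists[where f=f and ts="block u" and x=x, OF lab(1)] by (simp add: W_def block_def)
  have G_le: "G u \<le> k ^ q" for u
    using label_entropy_le_card[OF W(1), of "itinerary f lab (block u)" N] inW W(2) by (auto simp: G_def)
  have G_nn: "0 \<le> G u" for u unfolding G_def by (rule N.label_entropy_nonneg)

  have H_le: "H \<le> 2 * real (k ^ q) + (\<Sum>i<K. G (s + real i * q))" if s: "s \<in> {0..real q}" for s
  proof -
    \<comment> \<open>The block at 0 covers the times before the offset, since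
      \<open>s \<le> q\<close>; the blocks at \<open>s + i q\<close> cover
      \<open>[s, s + K q)\<close>, which contains \<open>[q, K q)\<close>; the last one covers
      \<open>[K q, t]\<close>, since \<open>t < K q + q\<close>. The two outer blocks do not depend
      on \<open>s\<close> and cost at most \<open>k ^ q\<close> each. Sample times may exceed
      \<open>t\<close>, which only adds labels.\<close>
    define tss where "tss = [block 0] @ map (\<lambda>i. block (s + real i * q)) [0..<K] @ [block (real K * q)]"
    have cover: "\<exists>\<tau>\<in>set (concat tss). \<tau> \<le> r \<and> r \<le> \<tau> + 1" if r: "r \<in> {0..t}" for r
    proof -
      have blockI: "u + real j \<in> set (block u)" if "j < q" for u j using that by (auto simp: block_def)
      have fl: "real (nat \<lfloor>v\<rfloor>) \<le> v" "v \<le> real (nat \<lfloor>v\<rfloor>) + 1" if "0 \<le> v" for v :: real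
        using floor_correct[of v] that by simp_all
      consider "r < q" | "real K * q \<le> r" | "q \<le> r" "r < real K * q" by linarith
      then show ?thesis
      proof cases
        case 1
        have "nat \<lfloor>r\<rfloor> < q" using 1 r by (simp add: nat_less_iff floor_less_iff)
        from blockI[OF this, of 0] have "real (nat \<lfloor>r\<rfloor>) \<in> set (concat tss)" by (simp add: tss_def)
        moreover have "real (nat \<lfloor>r\<rfloor>) \<le> r" "r \<le> real (nat \<lfloor>r\<rfloor>) + 1" using fl[of r] r by auto
        ultimately show ?thesis by blast
      next
        case 2
        define j where "j = nat \<lfloor>r - real K * q\<rfloor>"
        have j: "real j \<le> r - real K * q" "r - real K * q \<le> real j + 1"
          using fl[of "r - real K * q"] 2 by (auto simp: j_def)
        have "r - real K * q < q" using r Kq by auto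
        then have "j < q" using 2 by (simp add: j_def nat_less_iff floor_less_iff)
        from blockI[OF this, of "real K * q"] have "real K * q + real j \<in> set (concat tss)" by (simp add: tss_def)
        moreover have "real K * q + real j \<le> r" "r \<le> real K * q + real j + 1" using j by auto
        ultimately show ?thesis by blast
      next
        case 3
        define v where "v = nat \<lfloor>r - s\<rfloor>"
        have rs: "0 \<le> r - s" "r - s < real (K * q)" using 3 s by auto
        have v: "real v \<le> r - s" "r - s \<le> real v + 1" using fl[of "r - s"] rs by (auto simp: v_def)
        have "real v < real (K * q)" using v rs by linarith
        then have "v < K * q" by (simp only: of_nat_less_iff)
        then have vd: "v div q < K" "v mod q < q" using q by (auto simp: less_mult_imp_div_less)
        have "real v = real (v div q) * q + real (v mod q)" by (metis div_mult_mod_eq of_nat_add of_nat_mult)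
        then have sv: "s + real v = (s + real (v div q) * q) + real (v mod q)" by simp
        have "set (block (s + real (v div q) * q)) \<subseteq> set (concat tss)" using vd(1) by (auto simp: tss_def)
        with blockI[OF vd(2)] have "s + real v \<in> set (concat tss)" unfolding sv by blast
        moreover have "s + real v \<le> r" "r \<le> s + real v + 1" using v by auto
        ultimately show ?thesis by blast
      qed
    qed
    \<comment> \<open>Equal labels at a sample time \<open>\<tau>\<close> force distance at most
      \<open>\<epsilon>\<close> throughout \<open>[\<tau>, \<tau> + 1]\<close>, and these windows
      cover \<open>[0, t]\<close>; so equal words contradict separation.\<close>
    have "inj_on (itinerary f lab (concat tss)) E"
    proof (rule inj_onI, rule ccontr)
      fix x y assume xy: "x \<in> E" "y \<in> E" "itinerary f lab (concat tss) x = itinerary f lab (concat tss) y" "x \<noteq> y"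
      then obtain r where r: "r \<in> {0..t}" "\<epsilon> < dist (f r x) (f r y)" using sep unfolding separated_def by blast
      obtain \<tau> where \<tau>: "\<tau> \<in> set (concat tss)" "\<tau> \<le> r" "r \<le> \<tau> + 1" using cover[OF r(1)] by blast
      have X: "x \<in> X" "y \<in> X" using xy E by auto
      have "lab (f \<tau> x) = lab (f \<tau> y)" using xy(3) \<tau>(1) unfolding itinerary_def map_eq_conv by blast
      from close[OF flow_in[OF X(1)] flow_in[OF X(2)] this, of "r - \<tau>"] \<tau>
      have "dist (f (r - \<tau> + \<tau>) x) (f (r - \<tau> + \<tau>) y) \<le> \<epsilon>" unfolding flow_add[OF X(1)] flow_add[OF X(2)] by simp
      then show False using r by simp
    qed
    then have "H = label_entropy N (itinerary f lab (concat tss))"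
      unfolding N_def H_def using E w by (intro label_entropy_point_measure_inj[symmetric]) auto
    also have "\<dots> \<le> (\<Sum>ts\<leftarrow>tss. label_entropy N (itinerary f lab ts))"
      by (rule N.label_entropy_itinerary_concat_le) (rule sfN)
    also have "\<dots> = G 0 + (\<Sum>i<K. G (s + real i * q)) + G (real K * q)"
      by (simp add: tss_def G_def comp_def sum_set_upt_conv_sum_list_nat[symmetric] atLeast0LessThan
          flip: sum_set_upt_conv_sum_list_nat)
    finally show ?thesis using G_le[of 0] G_le[of "real K * q"] by simp
  qed

  define A where "A l = {y\<in>X. itinerary f lab (map real [0..<q]) y = l}" for l
  have A: "A l \<in> sets (restrict_space borel X)" for l
    unfolding A_def by (rule itinerary_fibre_measurable[OF lab(2)])
  \<comment> \<open>The weight of the points whose word read from time \<open>u\<close> on is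
    \<open>l\<close>. Its average over \<open>u\<close> in \<open>[0, t]\<close> is the
    \<open>\<mu>\<close>-measure of the fibre \<open>A l\<close>.\<close>
  define m where "m l u = (\<Sum>x\<in>E. w x * indicator (A l) (f u x))" for l u
  have m_meas: "m l \<in> borel_measurable borel" for l
  proof -
    have "(\<lambda>u. indicator (A l) (f u x) :: real) \<in> borel_measurable borel" if "x \<in> E" for x
      using measurable_comp[OF orbit_measurable borel_measurable_indicator[OF A[of l]], of x] that E by (auto simp: comp_def)
    then show ?thesis unfolding m_def[abs_def] by (intro borel_measurable_sum borel_measurable_times) auto
  qed
  have m_eq: "measure N {x\<in>space N. itinerary f lab (block u) x = l} = m l u" for l u
  proof -
    have "measure N {x\<in>space N. itinerary f lab (block u) x = l} = sum w {x\<in>E. itinerary f lab (block u) x = l}"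
      unfolding spN unfolding N_def by (rule measure_point_measure_finite) (use E w in auto)
    also have "\<dots> = (\<Sum>x\<in>E. if itinerary f lab (block u) x = l then w x else 0)"
      using E by (simp add: sum.inter_filter)
    also have "\<dots> = m l u"
      unfolding m_def
    proof (rule sum.cong[OF refl])
      fix x assume "x \<in> E"
      then have x: "x \<in> X" using E by auto
      then show "(if itinerary f lab (block u) x = l then w x else 0) = w x * indicator (A l) (f u x)"
        unfolding block_def itinerary_shift[OF x] A_def using flow_in[OF x, of u] by simp
    qed
    finally show ?thesis .
  qed
  have m01: "0 \<le> m l u" "m l u \<le> 1" for l u using m_eq[of u l] by (auto simp flip: m_eq)
  have G_eq: "G u = (\<Sum>l\<in>W. - m l u * ln (m l u))" for u
    unfolding G_def using label_entropy_eq_sum[OF W(1), of "itinerary f lab (block u)" N] inW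
    by (auto simp: m_eq)
  note [measurable] = m_meas
  have G_meas: "G \<in> borel_measurable borel"
    unfolding G_eq[abs_def] by measurable
  have G_int: "G integrable_on {a..b}" for a b
    by (rule bounded_borel_integrable_on[OF G_meas, of "k ^ q"]) (use G_le G_nn in auto)

  \<comment> \<open>Integrate \<open>H_le\<close> over the offset. The shifted block entropies tile
    \<open>[0, K q]\<close>, and enlarging this to \<open>[0, t]\<close> only helps because
    \<open>G\<close> is nonnegative.\<close>
  have "q * (H - 2 * real (k ^ q)) = integral {0..real q} (\<lambda>s. H - 2 * real (k ^ q))" by simp
  also have "\<dots> \<le> integral {0..real q} (\<lambda>s. \<Sum>i<K. G (s + real i * real q))"
  proof (rule integral_le)
    have "(\<lambda>s. G (s + c)) integrable_on {0..real q}" for c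
      by (rule bounded_borel_integrable_on[of _ "k ^ q"]) (use G_meas G_le G_nn in auto)
    then show "(\<lambda>s. \<Sum>i<K. G (s + real i * real q)) integrable_on {0..real q}" by (intro integrable_sum) auto
  qed (use H_le in fastforce)+
  also have "\<dots> = integral {0..real K * q} G" by (rule integral_sum_shifts) (auto intro: G_int)
  also have "\<dots> \<le> integral {0..t} G"
    by (rule integral_subset_le) (use Kq G_int G_nn in auto)
  also have "\<dots> = (\<Sum>l\<in>W. integral {0..t} (\<lambda>u. - m l u * ln (m l u)))"
    unfolding G_eq[abs_def]
  proof (rule integral_sum[OF W(1)])
    show "(\<lambda>u. - m l u * ln (m l u)) integrable_on {0..t}" for l
    proof (rule bounded_borel_integrable_on[of _ 1])
      show "(\<lambda>u. - m l u * ln (m l u)) \<in> borel_measurable borel" by measurable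
    qed (rule abs_minus_mult_ln_le_one[OF m01])
  qed
  \<comment> \<open>By concavity the time average of the entropies of the word laws is at most the
    entropy of the averaged law, which is the word law under \<open>\<mu>\<close>.\<close>
  also have "\<dots> \<le> (\<Sum>l\<in>W. t * (- measure \<mu> (A l) * ln (measure \<mu> (A l))))"
  proof (rule sum_mono)
    fix l
    have "measure \<mu> (A l) = integral\<^sup>L \<mu> (indicator (A l))"
      using A[of l] \<mu>(1) by (simp add: borel_prob_on_def)
    also have "\<dots> = (\<Sum>x\<in>E. w x * Birkhoff_int f (indicator (A l)) x t) / t"
      by (rule \<mu>(2)[of _ 1]) (use A[of l] in \<open>auto simp: indicator_def\<close>)
    also have "(\<Sum>x\<in>E. w x * Birkhoff_int f (indicator (A l)) x t) = (\<Sum>x\<in>E. integral {0..t} (\<lambda>u. w x * indicator (A l) (f u x)))"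
      unfolding Birkhoff_int_def by simp
    also have "\<dots> = integral {0..t} (m l)"
      unfolding m_def[abs_def]
    proof (rule integral_sum[OF E(1), symmetric])
      fix x assume "x \<in> E"
      then have "(\<lambda>u. indicator (A l) (f u x) :: real) \<in> borel_measurable borel"
        using measurable_comp[OF orbit_measurable borel_measurable_indicator[OF A[of l]], of x] E by (auto simp: comp_def)
      then have "(\<lambda>u. indicator (A l) (f u x) :: real) integrable_on {0..t}"
        by (rule bounded_borel_integrable_on[of _ 1]) (auto simp: indicator_def)
      then show "(\<lambda>u. w x * indicator (A l) (f u x)) integrable_on {0..t}" by (rule integrable_on_mult_right)
    qed
    finally show "integral {0..t} (\<lambda>u. - m l u * ln (m l u)) \<le> t * (- measure \<mu> (A l) * ln (measure \<mu> (A l)))"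
      using integral_minus_mult_ln_le[OF m_meas m01 t] by simp
  qed
  also have "\<dots> = t * label_entropy \<mu> (itinerary f lab (map real [0..<q]))"
  proof -
    have "itinerary f lab (map real [0..<q]) x \<in> W" for x
      using itinerary_in_lists[where f=f and ts="map real [0..<q]" and x=x, OF lab(1)] by (simp add: W_def)
    then have "itinerary f lab (map real [0..<q]) ` space \<mu> \<subseteq> W" by blast
    from label_entropy_eq_sum[OF W(1) this] show ?thesis
      unfolding borel_prob_on_space[OF \<mu>(1)] A_def by (simp only: sum_distrib_left)
  qed
  finally show ?thesis using t q unfolding H_def[symmetric] by (simp add: field_simps)
qed

end

section \<open>Invariant limits and entropy\<close>

text \<open>Only the limit 0 needs care, the logarithm being discontinuous there. Writing
  \<open>v\<close> as the square of \<open>sqrt v\<close> and bounding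
  \<open>- sqrt v * ln (sqrt v)\<close> by 1 gives the majorant \<open>2 * sqrt v\<close>.\<close>

lemma tendsto_mult_ln_nonneg:
  fixes u :: "nat \<Rightarrow> real"
  assumes u: "u \<longlonglongrightarrow> a" "\<And>n. 0 \<le> u n"
  shows "(\<lambda>n. u n * ln (u n)) \<longlonglongrightarrow> a * ln a"
proof (cases "a = 0")
  case False
  then show ?thesis using u(1) by (intro tendsto_mult tendsto_ln)
next
  case True
  have "norm (v * ln v) \<le> 2 * sqrt v" if "0 \<le> v" "v \<le> 1" for v :: real
  proof -
    have v: "v = sqrt v * sqrt v" using that by simp
    have "ln v = 2 * ln (sqrt v)" using that by (cases "v = 0") (auto simp: ln_sqrt)
    then have "- v * ln v = 2 * sqrt v * (- sqrt v * ln (sqrt v))"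
      using v by (metis (no_types, opaque_lifting) mult.assoc mult.commute mult_minus_left)
    also have "\<dots> \<le> 2 * sqrt v * 1" using that by (intro mult_left_mono minus_mult_ln_le_one) auto
    finally have "- v * ln v \<le> 2 * sqrt v" by simp
    moreover have "v * ln v \<le> 0" using that by (cases "v = 0") (auto intro: mult_nonneg_nonpos)
    ultimately show ?thesis by simp
  qed
  moreover have "\<forall>\<^sub>F n in sequentially. u n < 1" using order_tendstoD(2)[OF u(1)] True by simp
  ultimately have "\<forall>\<^sub>F n in sequentially. norm (u n * ln (u n)) \<le> 2 * sqrt (u n)"
    using u(2) by (auto elim!: eventually_mono)
  moreover have "(\<lambda>n. 2 * sqrt (u n)) \<longlonglongrightarrow> 0"
    using tendsto_mult_left[OF tendsto_real_sqrt[OF u(1)], of 2] True by simp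
  ultimately have "(\<lambda>n. u n * ln (u n)) \<longlonglongrightarrow> 0" by (rule Lim_null_comparison)
  then show ?thesis using True by simp
qed

context compact_flow
begin

lemma flow_invariantD:
  assumes "flow_invariant X f \<mu>"
  shows "borel_prob_on X \<mu>" "prob_space \<mu>" "space \<mu> = X" "sets \<mu> = sets (restrict_space borel X)"
    "A \<in> sets (restrict_space borel X) \<Longrightarrow> measure \<mu> {x\<in>X. f s x \<in> A} = measure \<mu> A"
proof -
  show b: "borel_prob_on X \<mu>" using assms by (simp add: flow_invariant_def)
  then show "prob_space \<mu>" and s: "sets \<mu> = sets (restrict_space borel X)" by (auto simp: borel_prob_on_def)
  show "space \<mu> = X" using b by (rule borel_prob_on_space)
  assume "A \<in> sets (restrict_space borel X)"
  then have "emeasure \<mu> (f s -` A \<inter> X) = emeasure \<mu> A" using assms s by (auto simp: flow_invariant_def)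
  moreover have "f s -` A \<inter> X = {x\<in>X. f s x \<in> A}" by auto
  ultimately show "measure \<mu> {x\<in>X. f s x \<in> A} = measure \<mu> A" by (simp add: measure_def)
qed

lemma flow_map_measurable_sets:
  assumes "sets \<mu> = sets (restrict_space borel X)"
  shows "f s \<in> measurable \<mu> \<mu>"
  using flow_map_measurable measurable_cong_sets[OF assms assms] by blast

lemma flow_invariant_integral:
  assumes inv: "flow_invariant X f \<mu>" and g: "continuous_on X (g :: 'a \<Rightarrow> real)"
  shows "(\<integral>x. g (f s x) \<partial>\<mu>) = integral\<^sup>L \<mu> g"
proof -
  note d = flow_invariantD[OF inv]
  note m = flow_map_measurable_sets[OF d(4)]
  have "distr \<mu> \<mu> (f s) = \<mu>"
  proof (rule measure_eqI)
    fix A assume "A \<in> sets (distr \<mu> \<mu> (f s))"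
    then show "emeasure (distr \<mu> \<mu> (f s)) A = emeasure \<mu> A"
      using inv d(3) by (simp add: emeasure_distr[OF m] flow_invariant_def)
  qed simp
  then show ?thesis
    using integral_distr[OF m[of s] continuous_on_borel_measurable_restrict[OF g d(4)]] by simp
qed

text \<open>Only forward times are tested, since averages over \<open>[0, t]\<close> are compared
  with their forward shifts. For negative \<open>s\<close>, the map \<open>f (- s)\<close> pulls the
  preimage of \<open>A\<close> back to \<open>A\<close> itself.\<close>

lemma flow_invariantI:
  assumes \<mu>: "borel_prob_on X \<mu>"
    and inv: "\<And>r (g :: 'a \<Rightarrow> real). 0 \<le> r \<Longrightarrow> continuous_on X g \<Longrightarrow> (\<integral>x. g (f r x) \<partial>\<mu>) = integral\<^sup>L \<mu> g"
  shows "flow_invariant X f \<mu>"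
proof -
  have sets: "sets \<mu> = sets (restrict_space borel X)" using \<mu> by (simp add: borel_prob_on_def)
  have sp: "space \<mu> = X" using \<mu> by (rule borel_prob_on_space)
  note m = flow_map_measurable_sets[OF sets]
  interpret prob_space \<mu> using \<mu> by (simp add: borel_prob_on_def)
  have nonneg: "emeasure \<mu> (f r -` A \<inter> X) = emeasure \<mu> A" if "0 \<le> r" and A: "A \<in> sets \<mu>" for r A
  proof -
    have "distr \<mu> \<mu> (f r) = \<mu>"
    proof (rule borel_prob_on_eqI[OF compact _ \<mu>])
      show "borel_prob_on X (distr \<mu> \<mu> (f r))"
        using prob_space_distr[OF m] sets by (simp add: borel_prob_on_def)
      show "integral\<^sup>L (distr \<mu> \<mu> (f r)) g = integral\<^sup>L \<mu> g" if "continuous_on X g" for g :: "'a \<Rightarrow> real"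
        using integral_distr[OF m[of r] continuous_on_borel_measurable_restrict[OF that sets]] inv[OF \<open>0 \<le> r\<close> that] by simp
    qed
    then show ?thesis using emeasure_distr[OF m[of r] A] sp by simp
  qed
  have "emeasure \<mu> (f s -` A \<inter> X) = emeasure \<mu> A" if A: "A \<in> sets \<mu>" for s A
  proof (cases "0 \<le> s")
    case False
    have "A \<subseteq> X" using sets.sets_into_space[OF A] sp by simp
    have "f (- s) -` (f s -` A \<inter> X) \<inter> X = A"
      using \<open>A \<subseteq> X\<close> flow_in flow_add[of _ s "- s"] flow_zero by auto
    moreover have "f s -` A \<inter> X \<in> sets \<mu>" using measurable_sets[OF m[of s] A] sp by simp
    ultimately show ?thesis using nonneg[of "- s" "f s -` A \<inter> X"] False by simp
  qed (use nonneg A in auto)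
  then show ?thesis using \<mu> by (simp add: flow_invariant_def)
qed

lemma continuous_on_comp_flow: "continuous_on X g \<Longrightarrow> continuous_on X (\<lambda>x. g (f s x))"
  using continuous_on_compose2[OF _ continuous_on_flow_map] flow_in by blast

lemma jordan_set_flow_preimage:
  assumes inv: "flow_invariant X f \<mu>" and A: "jordan_set X \<mu> A"
  shows "jordan_set X \<mu> {x\<in>X. f s x \<in> A}"
proof (rule jordan_setI)
  note d = flow_invariantD[OF inv]
  have "f s -` A \<inter> space \<mu> = {x\<in>X. f s x \<in> A}" using d(3) by auto
  then show "{x\<in>X. f s x \<in> A} \<in> sets \<mu>"
    using measurable_sets[OF flow_map_measurable_sets[OF d(4)]] A by (metis jordan_set_def)
  fix e :: real assume e: "0 < e"
  obtain g h :: "'a \<Rightarrow> real" where gh: "continuous_on X g" "continuous_on X h"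
    "\<And>x. x \<in> X \<Longrightarrow> g x \<le> indicator A x" "\<And>x. x \<in> X \<Longrightarrow> indicator A x \<le> h x" "(\<integral>x. h x - g x \<partial>\<mu>) < e"
    by (rule jordan_setD[OF A e]) (assumption | rule that)+
  have "(\<integral>x. h (f s x) - g (f s x) \<partial>\<mu>) = (\<integral>x. h x - g x \<partial>\<mu>)"
    by (rule flow_invariant_integral[OF inv, of "\<lambda>x. h x - g x"]) (intro continuous_intros gh)
  then show "\<exists>g h. continuous_on X g \<and> continuous_on X h \<and>
     (\<forall>x\<in>X. g x \<le> indicator {x\<in>X. f s x \<in> A} x \<and> indicator {x\<in>X. f s x \<in> A} x \<le> h x) \<and> (\<integral>x. h x - g x \<partial>\<mu>) < e"
    using gh(3-5) flow_in continuous_on_comp_flow[OF gh(1)] continuous_on_comp_flow[OF gh(2)]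
    by (intro exI[of _ "\<lambda>x. g (f s x)"] exI[of _ "\<lambda>x. h (f s x)"]) (auto simp: indicator_def)
qed

lemma jordan_set_itinerary_fibre:
  assumes inv: "flow_invariant X f \<mu>" and lab: "\<And>i. jordan_set X \<mu> {x\<in>X. lab x = i}"
  shows "jordan_set X \<mu> {x\<in>X. itinerary f lab ts x = l}"
proof (rule itinerary_fibre_induct[where P="jordan_set X \<mu>"])
  note \<mu> = flow_invariantD(1)[OF inv]
  show X: "jordan_set X \<mu> X" by (rule jordan_set_space[OF \<mu>])
  show "jordan_set X \<mu> {}" using jordan_set_compl[OF \<mu> X] by simp
  show "jordan_set X \<mu> (A \<inter> B)" if "jordan_set X \<mu> A" "jordan_set X \<mu> B" for A B
    using compact \<mu> that by (rule jordan_set_Int)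
  fix s i
  have eq: "{x\<in>X. f s x \<in> {x\<in>X. lab x = i}} = {x\<in>X. lab (f s x) = i}" using flow_in by auto
  from jordan_set_flow_preimage[OF inv lab, of s i] show "jordan_set X \<mu> {x\<in>X. lab (f s x) = i}"
    unfolding eq .
qed

lemma label_entropy_itinerary_eq_sum:
  assumes "\<And>x. lab x < (k::nat)" "space M = X"
  shows "label_entropy M (itinerary f lab ts) =
    (\<Sum>l\<in>{l. set l \<subseteq> {..<k} \<and> length l = length ts}.
       - measure M {x\<in>X. itinerary f lab ts x = l} * ln (measure M {x\<in>X. itinerary f lab ts x = l}))"
proof -
  have "itinerary f lab ts ` space M \<subseteq> {l. set l \<subseteq> {..<k} \<and> length l = length ts}"
    by (intro image_subsetI itinerary_in_lists assms(1))
  from label_entropy_eq_sum[OF card_bounded_lists(1) this] show ?thesis unfolding assms(2) .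
qed

text \<open>Entropy at a fixed word length is a continuous function of finitely many fibre measures,
  and every fibre is a continuity set of the invariant limit.\<close>

lemma tendsto_label_entropy_itinerary:
  assumes inv: "flow_invariant X f \<mu>" and \<mu>s: "\<And>n. borel_prob_on X (\<mu>s n)" and wc: "weak_conv_on X \<mu>s \<mu>"
    and lab: "\<And>x. lab x < (k::nat)" "\<And>i. jordan_set X \<mu> {x\<in>X. lab x = i}"
  shows "(\<lambda>n. label_entropy (\<mu>s n) (itinerary f lab ts)) \<longlonglongrightarrow> label_entropy \<mu> (itinerary f lab ts)"
proof -
  have "(\<lambda>n. measure (\<mu>s n) {x\<in>X. itinerary f lab ts x = l}) \<longlonglongrightarrow> measure \<mu> {x\<in>X. itinerary f lab ts x = l}" for l
    using compact \<mu>s flow_invariantD(1)[OF inv] wc jordan_set_itinerary_fibre[OF inv lab(2)]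
    by (rule tendsto_measure_jordan_set)
  then show ?thesis
    unfolding label_entropy_itinerary_eq_sum[of lab k, OF lab(1) borel_prob_on_space[OF \<mu>s]]
      label_entropy_itinerary_eq_sum[of lab k, OF lab(1) flow_invariantD(3)[OF inv]]
    by (simp only: mult_minus_left) (intro tendsto_sum tendsto_minus tendsto_mult_ln_nonneg measure_nonneg)
qed

lemma label_entropy_itinerary_shift:
  assumes inv: "flow_invariant X f \<mu>"
    and lab: "\<And>x. lab x < (k::nat)" "\<And>i. {x\<in>X. lab x = i} \<in> sets (restrict_space borel X)"
  shows "label_entropy \<mu> (itinerary f lab (map (\<lambda>s. u + s) ts)) = label_entropy \<mu> (itinerary f lab ts)"
proof -
  have "{x\<in>X. itinerary f lab (map (\<lambda>s. u + s) ts) x = l} = {x\<in>X. f u x \<in> {x\<in>X. itinerary f lab ts x = l}}" for l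
    using flow_in by (auto simp del: map_map simp: itinerary_shift)
  then have "measure \<mu> {x\<in>X. itinerary f lab (map (\<lambda>s. u + s) ts) x = l} = measure \<mu> {x\<in>X. itinerary f lab ts x = l}" for l
    using flow_invariantD(5)[OF inv itinerary_fibre_measurable[OF lab(2)]] by simp
  then show ?thesis
    unfolding label_entropy_itinerary_eq_sum[of lab k, OF lab(1) flow_invariantD(3)[OF inv]] by simp
qed

section \<open>Kolmogorov-Sinai entropy through itineraries\<close>

lemma flow_one_funpow: "x \<in> X \<Longrightarrow> (f 1 ^^ n) x = f (real n) x"
  by (induction n) (auto simp: flow_zero flow_add[symmetric])

text \<open>Taking only words realised on \<open>X\<close> matches the removal of the empty set in
  \<open>join\<close>. At \<open>n = 0\<close> the single cell \<open>space \<mu>\<close>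
  corresponds to the empty word, which is realised because \<open>X\<close> is nonempty.\<close>

lemma dyn_join_itinerary:
  assumes sp: "space \<mu> = X" and "X \<noteq> {}" and lab: "\<And>x. lab x < (k::nat)"
  defines "P \<equiv> (\<lambda>i. {x\<in>X. lab x = i}) ` {..<k} - {{}}"
  shows "dyn_join \<mu> (f 1) P n =
    (\<lambda>l. {x\<in>X. itinerary f lab (map real [0..<n]) x = l}) ` (itinerary f lab (map real [0..<n]) ` X)"
proof (induction n)
  case 0
  then show ?case using \<open>X \<noteq> {}\<close> by (auto simp: sp itinerary_def)
next
  case (Suc n)
  let ?c = "\<lambda>n. itinerary f lab (map real [0..<n])"
  have c: "?c (Suc n) x = ?c n x @ [lab (f (real n) x)]" for x by (simp add: itinerary_def)
  have pre: "(f 1 ^^ n) -` {x\<in>X. lab x = i} \<inter> X = {x\<in>X. lab (f (real n) x) = i}" for i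
    using flow_in by (auto simp: flow_one_funpow)
  show ?case
  proof (intro equalityI subsetI)
    fix S assume "S \<in> dyn_join \<mu> (f 1) P (Suc n)"
    then obtain A B where AB: "S = A \<inter> B" "S \<noteq> {}" "A \<in> dyn_join \<mu> (f 1) P n"
      "B \<in> (\<lambda>A. (f 1 ^^ n) -` A \<inter> space \<mu>) ` P"
      by (auto simp: join_def)
    from AB(3) obtain l where l: "A = {x\<in>X. ?c n x = l}" unfolding Suc by auto
    from AB(4) obtain i where i: "B = {x\<in>X. lab (f (real n) x) = i}" unfolding P_def sp using pre by auto
    have S: "S = {x\<in>X. ?c (Suc n) x = l @ [i]}" unfolding AB(1) l i c by auto
    with AB(2) obtain x where x: "x \<in> X" "?c (Suc n) x = l @ [i]" by auto
    show "S \<in> (\<lambda>l. {x\<in>X. ?c (Suc n) x = l}) ` (?c (Suc n) ` X)"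
      unfolding S x(2)[symmetric] by (intro imageI x(1))
  next
    fix S assume "S \<in> (\<lambda>l. {x\<in>X. ?c (Suc n) x = l}) ` (?c (Suc n) ` X)"
    then obtain x where x: "x \<in> X" "S = {y\<in>X. ?c (Suc n) y = ?c (Suc n) x}" by auto
    let ?A = "{y\<in>X. ?c n y = ?c n x}" and ?i = "lab (f (real n) x)"
    have S: "S = ?A \<inter> ((f 1 ^^ n) -` {y\<in>X. lab y = ?i} \<inter> space \<mu>)"
      unfolding x(2) sp pre c by auto
    have "?A \<in> dyn_join \<mu> (f 1) P n" unfolding Suc using x(1) by auto
    moreover have "{y\<in>X. lab y = ?i} \<in> P" unfolding P_def using lab flow_in[OF x(1)] by blast
    moreover have "S \<noteq> {}" using x by auto
    ultimately show "S \<in> dyn_join \<mu> (f 1) P (Suc n)" unfolding dyn_join.simps join_def using S by blast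
  qed
qed

text \<open>\<open>entropy_part\<close> is stated with \<open>lim\<close>, which carries information
  only once convergence is known; subadditivity provides it. A lower bound valid at every block
  length then passes to the limit.\<close>

lemma ks_entropy_ge_itinerary:
  assumes inv: "flow_invariant X f \<mu>"
    and lab: "\<And>x. lab x < (k::nat)" "\<And>i. {x\<in>X. lab x = i} \<in> sets (restrict_space borel X)"
    and le: "\<And>q. 0 < q \<Longrightarrow> c \<le> label_entropy \<mu> (itinerary f lab (map real [0..<q])) / q"
  shows "ereal c \<le> ks_entropy \<mu> (f 1)"
proof -
  note d = flow_invariantD[OF inv]
  interpret prob_space \<mu> by (rule d(2))
  have "X \<noteq> {}" using not_empty d(3) by simp
  define P where "P = (\<lambda>i. {x\<in>X. lab x = i}) ` {..<k} - {{}}"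
  define a where "a n = label_entropy \<mu> (itinerary f lab (map real [0..<n]))" for n
  have "finite_partition \<mu> P"
    unfolding finite_partition_def
  proof (intro conjI)
    show "P \<subseteq> sets \<mu>" unfolding P_def d(4) using lab(2) by auto
    show "\<Union>P = space \<mu>" unfolding P_def d(3) using lab(1) by auto
    show "disjoint P" unfolding P_def by (auto simp: disjoint_def)
  qed (auto simp: P_def)
  moreover have "part_entropy \<mu> (dyn_join \<mu> (f 1) P n) = a n" for n
  proof -
    let ?c = "itinerary f lab (map real [0..<n])"
    have "inj_on (\<lambda>l. {x\<in>X. ?c x = l}) (?c ` X)" by (rule inj_onI) blast
    then show ?thesis
      unfolding part_entropy_def P_def dyn_join_itinerary[OF d(3) \<open>X \<noteq> {}\<close> lab(1)] a_def label_entropy_def d(3)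
      by (subst sum.reindex) (auto simp: sum_negf[symmetric] intro!: sum.cong)
  qed
  then have "entropy_part \<mu> (f 1) P = lim (\<lambda>n. a n / n)" by (simp add: entropy_part_def)
  moreover have "c \<le> lim (\<lambda>n. a n / n)"
  proof (rule LIMSEQ_le_const)
    have "simple_function \<mu> (\<lambda>x. lab (f s x))" for s
      unfolding simple_function_def
    proof
      show "finite ((\<lambda>x. lab (f s x)) ` space \<mu>)" by (rule finite_subset[of _ "{..<k}"]) (use lab(1) in auto)
      have "(\<lambda>x. lab (f s x)) -` {i} \<inter> space \<mu> = {x\<in>X. lab (f s x) = i}" for i using d(3) by auto
      then show "\<forall>i\<in>(\<lambda>x. lab (f s x)) ` space \<mu>. (\<lambda>x. lab (f s x)) -` {i} \<inter> space \<mu> \<in> sets \<mu>"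
        using label_preimage_measurable[OF lab(2)] d(4) by simp
    qed
    \<comment> \<open>The last \<open>n\<close> times are the first \<open>n\<close> shifted by
      \<open>m\<close>, and by invariance the shifted block has the same entropy.\<close>
    then have "a (m + n) \<le> a m + a n" for m n
    proof -
      have "[0..<m + n] = [0..<m] @ map (\<lambda>j. m + j) [0..<n]" 
        by (simp add: map_add_upt upt_add_eq_append[of 0 m n, simplified] add.commute)
      then have "map real [0..<m + n] = map real [0..<m] @ map (\<lambda>s. real m + s) (map real [0..<n])" by simp
      then show ?thesis
        unfolding a_def
        using label_entropy_itinerary_append_le[of "map real [0..<m]" "map (\<lambda>s. real m + s) (map real [0..<n])" lab f]
          label_entropy_itinerary_shift[where u="real m" and ts="map real [0..<n]", OF inv lab]
          \<open>\<And>s. simple_function \<mu> (\<lambda>x. lab (f s x))\<close> by simp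
    qed
    then have "convergent (\<lambda>n. a n / n)"
      by (rule convergent_subadditive_quotient) (auto simp: a_def label_entropy_nonneg)
    then show "(\<lambda>n. a n / n) \<longlonglongrightarrow> lim (\<lambda>n. a n / n)" by (simp add: convergent_LIMSEQ_iff)
    show "\<exists>N. \<forall>n\<ge>N. c \<le> a n / n" using le by (intro exI[of _ 1]) (auto simp: a_def)
  qed
  ultimately show ?thesis
    unfolding ks_entropy_def by (intro SUP_upper2[of P]) auto
qed

end

section \<open>Pressure\<close>

text \<open>\<open>Lim\<close> is an unspecified value unless the limit exists. In the extended
  reals monotonicity guarantees existence and identifies the limit with an infimum.\<close>

lemma Lim_at_right_0_mono:
  fixes F :: "real \<Rightarrow> ereal"
  assumes "\<And>x y. 0 < x \<Longrightarrow> x \<le> y \<Longrightarrow> F x \<le> F y"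
  shows "Lim (at_right 0) F = (INF x\<in>{0<..}. F x)"
proof (rule tendsto_Lim)
  show "(F \<longlongrightarrow> (INF x\<in>{0<..}. F x)) (at_right 0)"
  proof (rule order_tendstoI)
    fix a assume a: "a < (INF x\<in>{0<..}. F x)"
    have "a < F x" if "0 < x" for x
      using a INF_lower[of x "{0<..}" F] that by (auto intro: less_le_trans)
    then show "\<forall>\<^sub>F x in at_right 0. a < F x" using eventually_at_right_less by (rule eventually_mono[rotated])
  next
    fix a assume "(INF x\<in>{0<..}. F x) < a"
    then obtain x0 where x0: "0 < x0" "F x0 < a" by (auto simp: INF_less_iff)
    have "\<forall>\<^sub>F x in at_right 0. x \<in> {0<..<x0}" using x0(1) by (rule eventually_at_right_real)
    then show "\<forall>\<^sub>F x in at_right 0. F x < a"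
    proof eventually_elim
      case (elim x)
      then have "F x \<le> F x0" using assms[of x x0] by simp
      then show ?case using x0(2) by simp
    qed
  qed
qed simp

lemma Lim_at_right_0_antimono:
  fixes F :: "real \<Rightarrow> ereal"
  assumes "\<And>x y. 0 < x \<Longrightarrow> x \<le> y \<Longrightarrow> F y \<le> F x"
  shows "Lim (at_right 0) F = (SUP x\<in>{0<..}. F x)"
proof (rule tendsto_Lim)
  show "(F \<longlongrightarrow> (SUP x\<in>{0<..}. F x)) (at_right 0)"
  proof (rule order_tendstoI)
    fix a assume a: "(SUP x\<in>{0<..}. F x) < a"
    have "F x < a" if "0 < x" for x
      using a SUP_upper[of x "{0<..}" F] that by (auto intro: le_less_trans)
    then show "\<forall>\<^sub>F x in at_right 0. F x < a" using eventually_at_right_less by (rule eventually_mono[rotated])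
  next
    fix a assume "a < (SUP x\<in>{0<..}. F x)"
    then obtain x0 where x0: "0 < x0" "a < F x0" by (auto simp: less_SUP_iff)
    have "\<forall>\<^sub>F x in at_right 0. x \<in> {0<..<x0}" using x0(1) by (rule eventually_at_right_real)
    then show "\<forall>\<^sub>F x in at_right 0. a < F x"
    proof eventually_elim
      case (elim x)
      then have "F x0 \<le> F x" using assms[of x x0] by simp
      with x0(2) show ?case by simp
    qed
  qed
qed simp

lemma Lambda_t_nonneg: "0 \<le> Lambda_t f C \<phi> \<epsilon> t"
  unfolding Lambda_t_def by (rule SUP_upper2[of "{}"]) (auto simp: separated_def)

lemma eln_mono: "0 \<le> a \<Longrightarrow> a \<le> b \<Longrightarrow> eln a \<le> eln b"
  by (cases a; cases b) (auto simp: eln_def)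

lemma pressure_eps_mono:
  assumes "C \<subseteq> C'" "\<delta> \<le> \<epsilon>"
  shows "pressure_eps f C \<phi> \<epsilon> \<le> pressure_eps f C' \<phi> \<delta>"
  unfolding pressure_eps_def
proof (rule Limsup_mono)
  have "Lambda_t f C \<phi> \<epsilon> t \<le> Lambda_t f C' \<phi> \<delta> t" for t
    unfolding Lambda_t_def
  proof (rule SUP_subset_mono)
    show "{E. finite E \<and> E \<subseteq> slice C t \<and> separated f t \<epsilon> E} \<subseteq> {E. finite E \<and> E \<subseteq> slice C' t \<and> separated f t \<delta> E}"
      using assms by (auto simp: slice_def separated_def) (meson le_less_trans)
  qed simp
  then have *: "eln (Lambda_t f C \<phi> \<epsilon> t) \<le> eln (Lambda_t f C' \<phi> \<delta> t)" for t by (intro eln_mono Lambda_t_nonneg)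
  show "\<forall>\<^sub>F t in at_top. ereal (1 / t) * eln (Lambda_t f C \<phi> \<epsilon> t) \<le> ereal (1 / t) * eln (Lambda_t f C' \<phi> \<delta> t)"
    using eventually_gt_at_top[of "0::real"] by eventually_elim (intro ereal_mult_left_mono *, auto)
qed

lemma pressure_eq_SUP: "pressure f C \<phi> = (SUP \<epsilon>\<in>{0<..}. pressure_eps f C \<phi> \<epsilon>)"
  unfolding pressure_def by (intro Lim_at_right_0_antimono pressure_eps_mono) auto

lemma pressure_mono: "C \<subseteq> C' \<Longrightarrow> pressure f C \<phi> \<le> pressure f C' \<phi>"
  unfolding pressure_eq_SUP by (intro SUP_mono') (auto intro: pressure_eps_mono)

text \<open>A limsup above \<open>c\<close> means excess at arbitrarily large times, so
  \<open>t\<close> can be asked to exceed any given \<open>T\<close>.\<close>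

lemma pressure_eps_gtD:
  assumes "ereal c < pressure_eps f C \<phi> \<epsilon>"
  obtains t E where "T < t" "0 < t" "finite E" "E \<subseteq> slice C t" "separated f t \<epsilon> E"
    "exp (c * t) < (\<Sum>x\<in>E. exp (Birkhoff_int f \<phi> x t))"
proof -
  have "\<not> (\<forall>\<^sub>F t in at_top. ereal (1 / t) * eln (Lambda_t f C \<phi> \<epsilon> t) \<le> ereal c)"
    using assms Limsup_bounded unfolding pressure_eps_def by (metis leD)
  then have "\<exists>\<^sub>F t in at_top. ereal c < ereal (1 / t) * eln (Lambda_t f C \<phi> \<epsilon> t)"
    by (simp add: frequently_def not_less)
  then have "\<exists>\<^sub>F t in at_top. ereal c < ereal (1 / t) * eln (Lambda_t f C \<phi> \<epsilon> t) \<and> max 0 T < t"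
    using eventually_gt_at_top[of "max 0 T"] by (rule frequently_eventually_frequently)
  then obtain t where t: "ereal c < ereal (1 / t) * eln (Lambda_t f C \<phi> \<epsilon> t)" "max 0 T < t"
    using frequently_ex by blast
  \<comment> \<open>The value 0 is impossible, because \<open>eln 0\<close> is
    \<open>-\<infinity>\<close>; an infinite value exceeds every real bound.\<close>
  have "ereal (exp (c * t)) < Lambda_t f C \<phi> \<epsilon> t"
  proof (cases "Lambda_t f C \<phi> \<epsilon> t")
    case (real r)
    have "0 \<le> r" using Lambda_t_nonneg[of f C \<phi> \<epsilon> t] real by simp
    moreover have "r \<noteq> 0" using t real by (auto simp: eln_def)
    ultimately have "r > 0" by simp
    moreover from this have "c * t < ln r" using t real by (auto simp: eln_def field_simps)
    ultimately have "exp (c * t) < r" by (metis exp_less_mono exp_ln)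
    then show ?thesis using real by simp
  next
    case MInf
    then show ?thesis using Lambda_t_nonneg[of f C \<phi> \<epsilon> t] by simp
  qed simp
  then obtain E where "finite E" "E \<subseteq> slice C t" "separated f t \<epsilon> E"
    "exp (c * t) < (\<Sum>x\<in>E. exp (Birkhoff_int f \<phi> x t))"
    unfolding Lambda_t_def less_SUP_iff by auto
  with t(2) show ?thesis by (intro that[of t E]) auto
qed

section \<open>From pressure to an invariant measure\<close>

context compact_flow
begin

lemma borel_bounded_orbit_integrable:
  assumes "g \<in> borel_measurable (restrict_space borel X)" "\<And>x. x \<in> X \<Longrightarrow> \<bar>g x\<bar> \<le> B" "x \<in> X"
  shows "(\<lambda>s. g (f s x) :: real) integrable_on {a..b}"
proof (rule bounded_borel_integrable_on)
  show "(\<lambda>s. g (f s x)) \<in> borel_measurable borel"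
    using measurable_comp[OF orbit_measurable[OF assms(3)] assms(1)] by (simp add: comp_def)
  show "\<bar>g (f s x)\<bar> \<le> B" for s using assms(2) flow_in[OF assms(3)] by simp
qed

text \<open>The windows \<open>[0, t]\<close> and \<open>[r, t + r]\<close> differ by two pieces of
  length \<open>r\<close>. The bound does not involve \<open>t\<close>, so division by
  \<open>t\<close> makes it vanish.\<close>

lemma Birkhoff_int_shift_le:
  assumes g: "g \<in> borel_measurable (restrict_space borel X)" "\<And>x. x \<in> X \<Longrightarrow> \<bar>g x\<bar> \<le> B"
    and x: "x \<in> X" and "0 \<le> r" "0 \<le> t"
  shows "\<bar>Birkhoff_int f (\<lambda>y. g (f r y)) x t - Birkhoff_int f g x t\<bar> \<le> 2 * B * r"
proof -
  let ?h = "\<lambda>s. g (f s x)"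
  have int: "?h integrable_on {a..b}" for a b
    using g x by (rule borel_bounded_orbit_integrable)
  have "Birkhoff_int f (\<lambda>y. g (f r y)) x t = integral {0..t} (?h \<circ> (\<lambda>s. r + s))"
    unfolding Birkhoff_int_def by (simp add: comp_def flow_add[OF x])
  also have "\<dots> = integral {r..t + r} ?h" by (subst integral_shift_Icc_real) simp
  finally have 1: "Birkhoff_int f (\<lambda>y. g (f r y)) x t = integral {r..t + r} ?h" .
  have 2: "integral {0..r} ?h + integral {r..t + r} ?h = integral {0..t} ?h + integral {t..t + r} ?h"
    using assms(4,5) by (simp add: Henstock_Kurzweil_Integration.integral_combine int)
  have B: "0 \<le> B" using g(2)[OF x] by linarith
  have 3: "\<bar>integral {a..b} ?h\<bar> \<le> B * (b - a)" if "a \<le> b" for a b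
    using has_integral_bound_real[OF B finite.emptyI integrable_integral[OF int[of a b]]] g(2) flow_in[OF x] that
    by simp
  show ?thesis
    using 1 2 3[of 0 r] 3[of t "t + r"] assms(4) unfolding Birkhoff_int_def by (simp add: algebra_simps)
qed

text \<open>Asking only for asymptotic invariance covers both the orbit averages and sequences of
  exactly invariant measures.\<close>

lemma weak_limit_flow_invariant:
  assumes \<mu>: "borel_prob_on X \<mu>" and wc: "weak_conv_on X \<mu>s \<mu>"
    and inv: "\<And>r (g :: 'a \<Rightarrow> real). 0 \<le> r \<Longrightarrow> continuous_on X g \<Longrightarrow>
      (\<lambda>n. (\<integral>x. g (f r x) \<partial>\<mu>s n) - integral\<^sup>L (\<mu>s n) g) \<longlonglongrightarrow> 0"
  shows "flow_invariant X f \<mu>"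
proof (rule flow_invariantI[OF \<mu>])
  fix r :: real and g :: "'a \<Rightarrow> real" assume "0 \<le> r" and g: "continuous_on X g"
  have "(\<lambda>n. (\<integral>x. g (f r x) \<partial>\<mu>s n) - integral\<^sup>L (\<mu>s n) g) \<longlonglongrightarrow> (\<integral>x. g (f r x) \<partial>\<mu>) - integral\<^sup>L \<mu> g"
    using wc g continuous_on_comp_flow[OF g] by (intro tendsto_diff) (auto simp: weak_conv_on_def)
  from LIMSEQ_unique[OF this inv[OF \<open>0 \<le> r\<close> g]] show "(\<integral>x. g (f r x) \<partial>\<mu>) = integral\<^sup>L \<mu> g" by simp
qed

text \<open>The time window has length 1, the spacing of the sample times within a block.\<close>

lemma uniform_flow_modulus:
  assumes "0 < \<epsilon>"
  obtains d where "0 < d"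
    "\<And>x y s. x \<in> X \<Longrightarrow> y \<in> X \<Longrightarrow> dist x y < d \<Longrightarrow> 0 \<le> s \<Longrightarrow> s \<le> 1 \<Longrightarrow> dist (f s x) (f s y) \<le> \<epsilon>"
proof -
  have "uniformly_continuous_on ({0..1} \<times> X) (\<lambda>(t, x). f t x)"
    using compact by (intro compact_uniformly_continuous compact_Times continuous_on_subset[OF continuous_on_flow]) auto
  then obtain d where d: "0 < d" "\<And>z z'. z \<in> {0..1} \<times> X \<Longrightarrow> z' \<in> {0..1} \<times> X \<Longrightarrow> dist z' z < d \<Longrightarrow>
      dist (case z' of (t, x) \<Rightarrow> f t x) (case z of (t, x) \<Rightarrow> f t x) < \<epsilon>"
    using assms unfolding uniformly_continuous_on_def by metis
  show ?thesis
  proof (rule that[OF d(1)])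
    fix x y s assume "x \<in> X" "y \<in> X" "dist x y < d" "0 \<le> s" "s \<le> (1::real)"
    then show "dist (f s x) (f s y) \<le> \<epsilon>"
      using d(2)[of "(s, y)" "(s, x)"] by (simp add: dist_Pair_Pair)
  qed
qed

text \<open>The labelling is chosen after the weak limit, because its cells must be continuity sets
  of \<open>\<mu>\<close>. The conclusion keeps the integral of \<open>\<phi>\<close> beside
  \<open>c\<close>, so it is meaningful when the entropy is infinite.\<close>

lemma invariant_measure_of_separated_growth:
  assumes \<phi>: "continuous_on X \<phi>"
    and lam: "lsc_on X lam" "\<And>x. x \<in> X \<Longrightarrow> 0 \<le> lam x" "bounded (lam ` X)"
    and "0 < \<epsilon>"
    and t: "\<And>n. real n < t n" "\<And>n. 0 < t n"
    and E: "\<And>n. finite (E n)" "\<And>n. E n \<subseteq> X" "\<And>n. separated f (t n) \<epsilon> (E n)"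
    and \<eta>: "\<And>n x. x \<in> E n \<Longrightarrow> Birkhoff_int f lam x (t n) / t n \<le> \<eta>"
    and growth: "\<And>n. exp (c * t n) < (\<Sum>x\<in>E n. exp (Birkhoff_int f \<phi> x (t n)))"
  obtains \<mu> where "flow_invariant X f \<mu>" "integral\<^sup>L \<mu> lam \<le> \<eta>"
    "ereal (c - integral\<^sup>L \<mu> \<phi>) \<le> ks_entropy \<mu> (f 1)"
proof -
  define Z where "Z n = (\<Sum>x\<in>E n. exp (Birkhoff_int f \<phi> x (t n)))" for n
  \<comment> \<open>Gibbs weights: their Shannon entropy is exactly \<open>ln (Z n)\<close> minus
    the mean Birkhoff integral, and that mean is \<open>t n\<close> times the integral of
    \<open>\<phi>\<close> against the orbit average.\<close>
  define w where "w n x = exp (Birkhoff_int f \<phi> x (t n)) / Z n" for n x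
  have Z: "0 < Z n" for n using growth[of n] exp_gt_zero[of "c * t n"] unfolding Z_def by linarith
  have w: "0 < w n x" "sum (w n) (E n) = 1" for n x
    using Z[of n] by (auto simp: w_def sum_divide_distrib[symmetric] Z_def[symmetric])
  have "\<forall>n. \<exists>\<mu>. borel_prob_on X \<mu> \<and> (\<forall>g B. g \<in> borel_measurable (restrict_space borel X) \<longrightarrow>
      (\<forall>x\<in>X. \<bar>g x\<bar> \<le> B) \<longrightarrow> integral\<^sup>L \<mu> g = (\<Sum>x\<in>E n. w n x * Birkhoff_int f g x (t n)) / t n)"
  proof
    fix n
    show "\<exists>\<mu>. borel_prob_on X \<mu> \<and> (\<forall>g B. g \<in> borel_measurable (restrict_space borel X) \<longrightarrow>
      (\<forall>x\<in>X. \<bar>g x\<bar> \<le> B) \<longrightarrow> integral\<^sup>L \<mu> g = (\<Sum>x\<in>E n. w n x * Birkhoff_int f g x (t n)) / t n)"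
      by (rule flow_average_measure[OF E(1)[of n] E(2)[of n] less_imp_le[OF w(1)[of n]] w(2)[of n] t(2)[of n]])
         (intro exI conjI allI impI, assumption, blast)
  qed
  from choice[OF this] obtain \<mu>s where \<mu>s: "\<And>n. borel_prob_on X (\<mu>s n)"
    "\<And>n g B. g \<in> borel_measurable (restrict_space borel X) \<Longrightarrow> (\<And>x. x \<in> X \<Longrightarrow> \<bar>g x\<bar> \<le> B) \<Longrightarrow>
       integral\<^sup>L (\<mu>s n) g = (\<Sum>x\<in>E n. w n x * Birkhoff_int f g x (t n)) / t n"
    by blast
  obtain r \<mu> where r: "strict_mono r" and \<mu>: "borel_prob_on X \<mu>" and wc: "weak_conv_on X (\<mu>s \<circ> r) \<mu>"
    by (rule borel_prob_on_sequentially_compact[OF compact \<mu>s(1)])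
  have bdd: "\<exists>B. \<forall>x\<in>X. \<bar>g x\<bar> \<le> B" if "continuous_on X g" for g :: "'a \<Rightarrow> real"
    using compact_imp_bounded[OF compact_continuous_image[OF that compact]] by (auto simp: bounded_iff)
  have "filterlim t at_top sequentially"
    by (rule filterlim_at_top_mono[OF filterlim_real_sequentially]) (simp add: less_imp_le[OF t(1)])
  then have tr: "filterlim (\<lambda>n. t (r n)) at_top sequentially"
    using filterlim_compose[OF _ filterlim_subseq[OF r], of t at_top] by simp
  have to0: "(\<lambda>n. C / t (r n)) \<longlonglongrightarrow> 0" for C
    using real_tendsto_divide_at_top[OF tendsto_const tr] .

  have inv: "flow_invariant X f \<mu>"
  proof (rule weak_limit_flow_invariant[OF \<mu> wc])
    fix u :: real and g :: "'a \<Rightarrow> real" assume u: "0 \<le> u" and g: "continuous_on X g"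
    obtain B where B: "\<And>x. x \<in> X \<Longrightarrow> \<bar>g x\<bar> \<le> B" using bdd[OF g] by blast
    have gm: "g \<in> borel_measurable (restrict_space borel X)" "(\<lambda>x. g (f u x)) \<in> borel_measurable (restrict_space borel X)"
      by (rule borel_measurable_continuous_on_restrict, intro g continuous_on_comp_flow)+
    have "\<bar>(\<integral>x. g (f u x) \<partial>\<mu>s n) - integral\<^sup>L (\<mu>s n) g\<bar> \<le> 2 * B * u / t n" for n
    proof -
      have i: "(\<integral>x. g (f u x) \<partial>\<mu>s n) = (\<Sum>x\<in>E n. w n x * Birkhoff_int f (\<lambda>x. g (f u x)) x (t n)) / t n"
        "integral\<^sup>L (\<mu>s n) g = (\<Sum>x\<in>E n. w n x * Birkhoff_int f g x (t n)) / t n"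
        using B flow_in by (auto intro!: \<mu>s(2) gm)
      have "\<bar>\<Sum>x\<in>E n. w n x * (Birkhoff_int f (\<lambda>x. g (f u x)) x (t n) - Birkhoff_int f g x (t n))\<bar>
        \<le> (\<Sum>x\<in>E n. w n x * (2 * B * u))"
      proof (rule order_trans[OF sum_abs sum_mono])
        fix x assume "x \<in> E n"
        then have "x \<in> X" using E(2) by blast
        from Birkhoff_int_shift_le[OF gm(1) B this u less_imp_le[OF t(2)]] w(1)[of n x]
        show "\<bar>w n x * (Birkhoff_int f (\<lambda>x. g (f u x)) x (t n) - Birkhoff_int f g x (t n))\<bar> \<le> w n x * (2 * B * u)"
          by (simp add: abs_mult mult.assoc)
      qed
      also have "\<dots> = 2 * B * u" using w(2)[of n] by (simp add: sum_distrib_right[symmetric])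
      finally have "\<bar>(\<Sum>x\<in>E n. w n x * Birkhoff_int f (\<lambda>x. g (f u x)) x (t n)) - (\<Sum>x\<in>E n. w n x * Birkhoff_int f g x (t n))\<bar> \<le> 2 * B * u"
        by (simp add: sum_subtractf right_diff_distrib)
      then show ?thesis
        unfolding i diff_divide_distrib[symmetric] using t(2)[of n] by (simp add: divide_right_mono)
    qed
    then show "(\<lambda>n. (\<integral>x. g (f u x) \<partial>(\<mu>s \<circ> r) n) - integral\<^sup>L ((\<mu>s \<circ> r) n) g) \<longlonglongrightarrow> 0"
      by (intro Lim_null_comparison[OF always_eventually to0[of "2 * B * u"]]) simp
  qed

  have lam_le: "integral\<^sup>L \<mu> lam \<le> \<eta>"
  proof (rule integral_lsc_le_weak_limit[OF compact lam _ \<mu> wc _ tendsto_const])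
    fix n
    show "borel_prob_on X ((\<mu>s \<circ> r) n)" using \<mu>s(1) by simp
    obtain B where "\<And>x. x \<in> X \<Longrightarrow> \<bar>lam x\<bar> \<le> B" using lam(3) by (auto simp: bounded_iff)
    then have "integral\<^sup>L (\<mu>s m) lam = (\<Sum>x\<in>E m. w m x * (Birkhoff_int f lam x (t m) / t m))" for m
      using \<mu>s(2)[OF lsc_on_borel_measurable[OF lam(1,2)], of B m] by (simp add: sum_divide_distrib)
    also have "(\<Sum>x\<in>E m. w m x * (Birkhoff_int f lam x (t m) / t m)) \<le> (\<Sum>x\<in>E m. w m x * \<eta>)" for m
      using \<eta> w(1) by (intro sum_mono mult_left_mono) (auto intro: less_imp_le)
    also have "(\<Sum>x\<in>E m. w m x * \<eta>) = \<eta>" for m using w(2)[of m] by (simp add: sum_distrib_right[symmetric])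
    finally show "integral\<^sup>L ((\<mu>s \<circ> r) n) lam \<le> \<eta>" by simp
  qed

  obtain d where d: "0 < d"
    "\<And>x y s. x \<in> X \<Longrightarrow> y \<in> X \<Longrightarrow> dist x y < d \<Longrightarrow> 0 \<le> s \<Longrightarrow> s \<le> 1 \<Longrightarrow> dist (f s x) (f s y) \<le> \<epsilon>"
    by (rule uniform_flow_modulus[OF \<open>0 < \<epsilon>\<close>]) (assumption | rule that)+
  obtain lab :: "'a \<Rightarrow> nat" and k where lab: "\<And>x. lab x < k"
    "\<And>x y. x \<in> X \<Longrightarrow> y \<in> X \<Longrightarrow> lab x = lab y \<Longrightarrow> dist x y < d"
    "\<And>i. jordan_set X \<mu> {x\<in>X. lab x = i}"
    by (rule jordan_labelling[OF compact \<mu> d(1)]) (assumption | rule that)+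
  have lab_meas: "{x\<in>X. lab x = i} \<in> sets (restrict_space borel X)" for i
    using lab(3)[of i] \<mu> by (simp add: jordan_set_def borel_prob_on_def)
  obtain B where B: "\<And>x. x \<in> X \<Longrightarrow> \<bar>\<phi> x\<bar> \<le> B" using bdd[OF \<phi>] by blast
  have int_\<phi>: "integral\<^sup>L (\<mu>s n) \<phi> = (\<Sum>x\<in>E n. w n x * Birkhoff_int f \<phi> x (t n)) / t n" for n
    by (rule \<mu>s(2)[OF borel_measurable_continuous_on_restrict[OF \<phi>] B])
  have ent: "ln (Z n) / t n - integral\<^sup>L (\<mu>s n) \<phi> \<le>
      2 * real (k ^ q) / t n + label_entropy (\<mu>s n) (itinerary f lab (map real [0..<q])) / q" if q: "0 < q" for n q
  proof -
    have "(\<Sum>x\<in>E n. - w n x * ln (w n x)) = (\<Sum>x\<in>E n. w n x * ln (Z n) - w n x * Birkhoff_int f \<phi> x (t n))"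
    proof (rule sum.cong[OF refl])
      fix x
      have lnw: "ln (w n x) = Birkhoff_int f \<phi> x (t n) - ln (Z n)"
        unfolding w_def using Z[of n] by (simp add: ln_div)
      show "- w n x * ln (w n x) = w n x * ln (Z n) - w n x * Birkhoff_int f \<phi> x (t n)"
        unfolding lnw by (simp add: algebra_simps)
    qed
    also have "\<dots> = ln (Z n) - (\<Sum>x\<in>E n. w n x * Birkhoff_int f \<phi> x (t n))"
      using w(2)[of n] by (simp add: sum_subtractf sum_distrib_right[symmetric])
    finally have "(\<Sum>x\<in>E n. - w n x * ln (w n x)) / t n = ln (Z n) / t n - integral\<^sup>L (\<mu>s n) \<phi>"
      by (simp add: int_\<phi> diff_divide_distrib)
    moreover have "(\<Sum>x\<in>E n. - w n x * ln (w n x)) / t n \<le>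
      2 * real (k ^ q) / t n + label_entropy (\<mu>s n) (itinerary f lab (map real [0..<q])) / q"
    proof (rule separated_entropy_le[OF E(1)[of n] E(2)[of n] less_imp_le[OF w(1)[of n]] w(2)[of n] t(2)[of n] E(3)[of n]
          lab(1) lab_meas _ \<mu>s(1)[of n] _ q])
      fix x y s assume "x \<in> X" "y \<in> X" "lab x = lab y" "0 \<le> s" "s \<le> (1::real)"
      then show "dist (f s x) (f s y) \<le> \<epsilon>" using d(2) lab(2) by blast
    next
      fix g :: "'a \<Rightarrow> real" and B assume "g \<in> borel_measurable (restrict_space borel X)" "\<And>x. x \<in> X \<Longrightarrow> \<bar>g x\<bar> \<le> B"
      then show "integral\<^sup>L (\<mu>s n) g = (\<Sum>x\<in>E n. w n x * Birkhoff_int f g x (t n)) / t n" by (rule \<mu>s(2))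
    qed
    ultimately show ?thesis by simp
  qed
  have lnZ: "c < ln (Z n) / t n" for n
  proof -
    have "c * t n < ln (Z n)" using growth[of n] Z[of n] unfolding Z_def[symmetric] by (metis exp_less_cancel_iff exp_ln)
    then show ?thesis using t(2)[of n] by (simp add: field_simps)
  qed
  \<comment> \<open>With \<open>q\<close> fixed the boundary cost \<open>2 * k ^ q / t\<close> tends
    to 0, however fast \<open>k ^ q\<close> grows with \<open>q\<close>.\<close>
  have "c - integral\<^sup>L \<mu> \<phi> \<le> label_entropy \<mu> (itinerary f lab (map real [0..<q])) / q" if q: "0 < q" for q
  proof -
    have "(\<lambda>n. c - integral\<^sup>L ((\<mu>s \<circ> r) n) \<phi> - 2 * real (k ^ q) / t (r n)) \<longlonglongrightarrow> c - integral\<^sup>L \<mu> \<phi> - 0"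
      using wc \<phi> by (intro tendsto_diff tendsto_const to0) (auto simp: weak_conv_on_def)
    moreover have "(\<lambda>n. label_entropy ((\<mu>s \<circ> r) n) (itinerary f lab (map real [0..<q])) / q)
       \<longlonglongrightarrow> label_entropy \<mu> (itinerary f lab (map real [0..<q])) / q"
      using q by (intro tendsto_divide tendsto_const tendsto_label_entropy_itinerary[OF inv _ wc lab(1,3)]) (auto intro: \<mu>s(1))
    ultimately have "c - integral\<^sup>L \<mu> \<phi> - 0 \<le> label_entropy \<mu> (itinerary f lab (map real [0..<q])) / q"
    proof (rule LIMSEQ_le)
      have "c - integral\<^sup>L (\<mu>s m) \<phi> - 2 * real (k ^ q) / t m \<le> label_entropy (\<mu>s m) (itinerary f lab (map real [0..<q])) / q" for m
        using ent[OF q, of m] lnZ[of m] by linarith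
      then show "\<exists>N. \<forall>n\<ge>N. c - integral\<^sup>L ((\<mu>s \<circ> r) n) \<phi> - 2 * real (k ^ q) / t (r n)
        \<le> label_entropy ((\<mu>s \<circ> r) n) (itinerary f lab (map real [0..<q])) / q" by simp
    qed
    then show ?thesis by simp
  qed
  then have "ereal (c - integral\<^sup>L \<mu> \<phi>) \<le> ks_entropy \<mu> (f 1)"
    by (rule ks_entropy_ge_itinerary[OF inv lab(1) lab_meas])
  with inv lam_le that show ?thesis by blast
qed

lemma invariant_measure_of_pressure_gt:
  assumes \<phi>: "continuous_on X \<phi>"
    and lam: "lsc_on X lam" "\<And>x. x \<in> X \<Longrightarrow> 0 \<le> lam x" "bounded (lam ` X)"
    and gt: "ereal c < pressure f {(x, t). x \<in> X \<and> t > 0 \<and> Birkhoff_int f lam x t / t \<le> \<eta>} \<phi>"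
  obtains \<mu> where "flow_invariant X f \<mu>" "integral\<^sup>L \<mu> lam \<le> \<eta>"
    "ereal (c - integral\<^sup>L \<mu> \<phi>) \<le> ks_entropy \<mu> (f 1)"
proof -
  let ?C = "{(x, t). x \<in> X \<and> t > 0 \<and> Birkhoff_int f lam x t / t \<le> \<eta>}"
  obtain \<epsilon> where \<epsilon>: "0 < \<epsilon>" "ereal c < pressure_eps f ?C \<phi> \<epsilon>"
    using gt unfolding pressure_eq_SUP less_SUP_iff by auto
  have "\<forall>n. \<exists>p. real n < fst p \<and> 0 < fst p \<and> finite (snd p) \<and> snd p \<subseteq> slice ?C (fst p) \<and> separated f (fst p) \<epsilon> (snd p) \<and>
    exp (c * fst p) < (\<Sum>x\<in>snd p. exp (Birkhoff_int f \<phi> x (fst p)))"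
  proof
    fix n
    obtain t E where "real n < t" "0 < t" "finite E" "E \<subseteq> slice ?C t" "separated f t \<epsilon> E"
      "exp (c * t) < (\<Sum>x\<in>E. exp (Birkhoff_int f \<phi> x t))"
      by (rule pressure_eps_gtD[OF \<epsilon>(2), of "real n"])
    then show "\<exists>p. real n < fst p \<and> 0 < fst p \<and> finite (snd p) \<and> snd p \<subseteq> slice ?C (fst p) \<and> separated f (fst p) \<epsilon> (snd p) \<and>
      exp (c * fst p) < (\<Sum>x\<in>snd p. exp (Birkhoff_int f \<phi> x (fst p)))"
      by (intro exI[of _ "(t, E)"]) simp
  qed
  from choice[OF this] obtain p where p: "\<And>n. real n < fst (p n)" "\<And>n. 0 < fst (p n)" "\<And>n. finite (snd (p n))"
    "\<And>n. snd (p n) \<subseteq> slice ?C (fst (p n))" "\<And>n. separated f (fst (p n)) \<epsilon> (snd (p n))"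
    "\<And>n. exp (c * fst (p n)) < (\<Sum>x\<in>snd (p n). exp (Birkhoff_int f \<phi> x (fst (p n))))"
    by blast
  have "snd (p n) \<subseteq> X" "x \<in> snd (p n) \<Longrightarrow> Birkhoff_int f lam x (fst (p n)) / fst (p n) \<le> \<eta>" for n x
    using p(4)[of n] by (auto simp: slice_def)
  from invariant_measure_of_separated_growth[OF \<phi> lam \<epsilon>(1) p(1,2,3) this(1) p(5) this(2) p(6)] that
  show ?thesis by blast
qed

end

section \<open>The limit as \<open>\<eta>\<close> tends to 0\<close>

theorem theorem3p6:
  fixes X :: "'a::metric_space set"
    and f :: "real \<Rightarrow> 'a \<Rightarrow> 'a"
    and \<phi> lam :: "'a \<Rightarrow> real"
  assumes "compact X"
    and "continuous_flow X f"
    and "continuous_on X \<phi>"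
    and "\<forall>x\<in>X. 0 \<le> lam x"
    and "bounded (lam ` X)"
    and "lsc_on X lam"
    and "entropy_usc X f"
  shows "Lim (at_right 0)
           (\<lambda>\<eta>::real. pressure f {(x, t). x \<in> X \<and> t > 0 \<and> Birkhoff_int f lam x t / t \<le> \<eta>} \<phi>)
         \<le> (SUP \<mu>\<in>{\<mu>. flow_invariant X f \<mu> \<and> integral\<^sup>L \<mu> lam = 0}.
              ks_entropy \<mu> (f 1) + ereal (integral\<^sup>L \<mu> \<phi>))"
    (is "Lim _ ?p \<le> ?R")
proof (rule ccontr)
  assume "\<not> Lim (at_right 0) ?p \<le> ?R"
  moreover have "Lim (at_right 0) ?p = (INF \<eta>\<in>{0<..}. ?p \<eta>)"
    by (intro Lim_at_right_0_mono pressure_mono) auto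
  ultimately have "?R < (INF \<eta>\<in>{0<..}. ?p \<eta>)" by (simp only: not_le)
  \<comment> \<open>A real number strictly between also treats the value \<open>-\<infinity>\<close>
    of an empty supremum: the measure constructed below then contradicts emptiness.\<close>
  from ereal_dense2[OF this] obtain c where c: "?R < ereal c" "ereal c < (INF \<eta>\<in>{0<..}. ?p \<eta>)" by blast
  interpret compact_flow X f using assms(1,2) by unfold_locales
  have lam: "\<And>x. x \<in> X \<Longrightarrow> 0 \<le> lam x" using assms(4) by blast
  have "\<forall>n. \<exists>\<mu>. flow_invariant X f \<mu> \<and> integral\<^sup>L \<mu> lam \<le> 1 / Suc n \<and>
    ereal (c - integral\<^sup>L \<mu> \<phi>) \<le> ks_entropy \<mu> (f 1)"
  proof
    fix n :: nat
    have "ereal c < ?p (1 / Suc n)"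
      by (rule less_le_trans[OF c(2) INF_lower]) simp
    from invariant_measure_of_pressure_gt[OF assms(3,6) lam assms(5) this]
    show "\<exists>\<mu>. flow_invariant X f \<mu> \<and> integral\<^sup>L \<mu> lam \<le> 1 / Suc n \<and>
      ereal (c - integral\<^sup>L \<mu> \<phi>) \<le> ks_entropy \<mu> (f 1)" by blast
  qed
  from choice[OF this] obtain \<mu>s where \<mu>s: "\<And>n. flow_invariant X f (\<mu>s n)"
    "\<And>n. integral\<^sup>L (\<mu>s n) lam \<le> 1 / Suc n" "\<And>n. ereal (c - integral\<^sup>L (\<mu>s n) \<phi>) \<le> ks_entropy (\<mu>s n) (f 1)"
    by blast
  obtain r \<mu> where r: "strict_mono r" and \<mu>: "borel_prob_on X \<mu>" and wc: "weak_conv_on X (\<mu>s \<circ> r) \<mu>"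
    by (rule borel_prob_on_sequentially_compact[OF compact flow_invariantD(1)[OF \<mu>s(1)]])
  have inv: "flow_invariant X f \<mu>"
    by (rule weak_limit_flow_invariant[OF \<mu> wc]) (simp add: flow_invariant_integral[OF \<mu>s(1)])
  have "integral\<^sup>L \<mu> lam \<le> 0"
  proof (rule integral_lsc_le_weak_limit[OF compact assms(6) lam assms(5) _ \<mu> wc])
    show "borel_prob_on X ((\<mu>s \<circ> r) n)" for n using flow_invariantD(1)[OF \<mu>s(1)] by simp
    show "integral\<^sup>L ((\<mu>s \<circ> r) n) lam \<le> 1 / Suc (r n)" for n using \<mu>s(2) by simp
    show "(\<lambda>n. 1 / real (Suc (r n))) \<longlonglongrightarrow> 0"
      using LIMSEQ_subseq_LIMSEQ[OF LIMSEQ_inverse_real_of_nat r] by (simp add: comp_def inverse_eq_divide)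
  qed
  moreover have "0 \<le> integral\<^sup>L \<mu> lam"
    using lam borel_prob_on_space[OF \<mu>] by (intro Bochner_Integration.integral_nonneg) simp
  ultimately have "ks_entropy \<mu> (f 1) + ereal (integral\<^sup>L \<mu> \<phi>) \<le> ?R"
    using inv by (intro SUP_upper) simp
  moreover have "ereal (c - integral\<^sup>L \<mu> \<phi>) \<le> ks_entropy \<mu> (f 1)"
  proof -
    \<comment> \<open>The integrals of \<open>\<phi>\<close> converge, so the lower bounds have a
      true limit, which can be compared with the limsup of the entropies.\<close>
    have "(\<lambda>n. ereal (c - integral\<^sup>L ((\<mu>s \<circ> r) n) \<phi>)) \<longlonglongrightarrow> ereal (c - integral\<^sup>L \<mu> \<phi>)"
      using wc assms(3) by (intro tendsto_ereal tendsto_diff tendsto_const) (simp add: weak_conv_on_def)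
    then have "ereal (c - integral\<^sup>L \<mu> \<phi>) = limsup (\<lambda>n. ereal (c - integral\<^sup>L ((\<mu>s \<circ> r) n) \<phi>))"
      using lim_imp_Limsup[OF sequentially_bot] by metis
    also have "\<dots> \<le> limsup (\<lambda>n. ks_entropy ((\<mu>s \<circ> r) n) (f 1))"
      using \<mu>s(3) by (intro Limsup_mono always_eventually) simp
    also have "\<dots> \<le> ks_entropy \<mu> (f 1)"
      by (rule assms(7)[unfolded entropy_usc_def, rule_format, OF _ inv wc]) (simp add: \<mu>s(1))
    finally show ?thesis .
  qed
  then have "ereal c \<le> ks_entropy \<mu> (f 1) + ereal (integral\<^sup>L \<mu> \<phi>)"
    by (cases "ks_entropy \<mu> (f 1)") auto
  ultimately show False using c(1) by (meson leD order_trans)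
qed

end
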